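(* Let $L_1,\ldots,L_8$ be general linear forms in $\mathbb{C}[x_0,\ldots,x_6]$. Then the ideal $I=(L_1^3,\ldots,L_8^3)\subset\mathbb{C}[x_0,\ldots,x_6]$ fails the weak Lefschetz property (WLP) in degree $5$.
   Context: Let $R=\mathbb{C}[x_0,\ldots,x_6]$ with the standard grading, let $I=(L_1^3,\ldots,L_8^3)$, and let $A=R/I=\bigoplus_i A_i$ be the associated graded Artinian ring. The ideal $I$ has the weak Lefschetz property (WLP) in degree $i$ if, for a general linear form $L\in R_1$, the multiplication map $\times L: A_i\to A_{i+1}$ has maximal rank (i.e. is injective or surjective); it fails the WLP in degree $i$ if, for a general linear form $L$, this map does not have maximal rank. "General linear forms $L_1,\ldots,L_8$" means that the assertion holds for all $(L_1,\ldots,L_8)$ in some nonempty Zariski open subset of $(R_1)^8$; similarly, "a general linear form $L$" means all $L$ in some nonempty Zariski open subset of $R_1$. *)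

theory Defs
  imports
    Complex_Main
    "HOL-Library.Poly_Mapping"
    "HOL-Library.Numeral_Type"
    "HOL-Algebra.QuotRing"
    "HOL-Algebra.Algebraic_Closure_Type"
begin

text \<open>
  Polynomials over the complex numbers in finitely many variables indexed by a finite type, as
  finitely supported functions from exponent vectors to coefficients; the type class instances of
  the library make this the usual commutative polynomial ring.
  The seven variables x0, ..., x6 are indexed by the seven-element type \<open>7\<close>.
\<close>

type_synonym 'n mpoly = "('n \<Rightarrow>\<^sub>0 nat) \<Rightarrow>\<^sub>0 complex"

definition mpoly_eval :: "'n::finite mpoly \<Rightarrow> ('n \<Rightarrow> complex) \<Rightarrow> complex" where
  "mpoly_eval p v =
     (\<Sum>m\<in>Poly_Mapping.keys p.
        Poly_Mapping.lookup p m * (\<Prod>i\<in>UNIV. v i ^ Poly_Mapping.lookup m i))"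

definition homogeneous :: "nat \<Rightarrow> 'n::finite mpoly set" where
  "homogeneous d =
     {p. \<forall>m\<in>Poly_Mapping.keys p. (\<Sum>i\<in>UNIV. Poly_Mapping.lookup m i) = d}"

definition lin_form :: "('n::finite \<Rightarrow> complex) \<Rightarrow> 'n mpoly" where
  "lin_form c = (\<Sum>i\<in>UNIV. Poly_Mapping.single (Poly_Mapping.single i 1) (c i))"


definition zariski_closed :: "('k::finite \<Rightarrow> complex) set \<Rightarrow> bool" where
  "zariski_closed Z \<longleftrightarrow> (\<exists>F :: 'k mpoly set. Z = {v. \<forall>p\<in>F. mpoly_eval p v = 0})"

definition zariski_open :: "('k::finite \<Rightarrow> complex) set \<Rightarrow> bool" where
  "zariski_open U \<longleftrightarrow> zariski_closed (- U)"

definition holds_generically :: "(('k::finite \<Rightarrow> complex) \<Rightarrow> bool) \<Rightarrow> bool" where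
  "holds_generically P \<longleftrightarrow> (\<exists>U. zariski_open U \<and> U \<noteq> {} \<and> (\<forall>v\<in>U. P v))"

text \<open>
  The space of linear forms, and the space of tuples of linear forms, are affine spaces via the
  coefficients of the forms.
\<close>

definition general_linear_form :: "('n::finite mpoly \<Rightarrow> bool) \<Rightarrow> bool" where
  "general_linear_form P \<longleftrightarrow> holds_generically (\<lambda>c. P (lin_form c))"

definition general_linear_forms :: "(('j::finite \<Rightarrow> 'n::finite mpoly) \<Rightarrow> bool) \<Rightarrow> bool" where
  "general_linear_forms P \<longleftrightarrow>
     holds_generically (\<lambda>c :: 'j \<times> 'n \<Rightarrow> complex. P (\<lambda>j. lin_form (\<lambda>i. c (j, i))))"


abbreviation mpoly_ring :: "'n::finite mpoly ring" where
  "mpoly_ring \<equiv> ring_of_type_algebra"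

definition quotient_part :: "'n::finite mpoly set \<Rightarrow> nat \<Rightarrow> 'n mpoly set set" where
  "quotient_part I d = (\<lambda>f. I +>\<^bsub>mpoly_ring\<^esub> f) ` homogeneous d"

definition mult_map :: "'n::finite mpoly set \<Rightarrow> 'n mpoly \<Rightarrow> 'n mpoly set \<Rightarrow> 'n mpoly set" where
  "mult_map I L a = (I +>\<^bsub>mpoly_ring\<^esub> L) \<otimes>\<^bsub>mpoly_ring Quot I\<^esub> a"

definition maximal_rank :: "'n::finite mpoly set \<Rightarrow> 'n mpoly \<Rightarrow> nat \<Rightarrow> bool" where
  "maximal_rank I L d \<longleftrightarrow>
     inj_on (mult_map I L) (quotient_part I d) \<or>
     mult_map I L ` quotient_part I d = quotient_part I (Suc d)"

definition fails_WLP_in_degree :: "'n::finite mpoly set \<Rightarrow> nat \<Rightarrow> bool" where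
  "fails_WLP_in_degree I d \<longleftrightarrow> general_linear_form (\<lambda>L. \<not> maximal_rank I L d)"

end

theory Submission
  imports
    Defs
    "HOL-Computational_Algebra.Formal_Power_Series"
    "HOL-Analysis.Determinants"
begin

text \<open>
  The map \<open>\<times>L : A\<^sub>5 \<rightarrow> A\<^sub>6\<close> fails to be surjective for reasons of dimension, and fails to be injective
  because of the rational normal curve through eight points.

  Write the linear relation among the eight forms as \<open>\<Sum>\<^sub>j M\<^sub>j = 0\<close> with \<open>M\<^sub>j\<close> a nonzero multiple of \<open>L\<^sub>j\<close>,
  which leaves \<open>I\<close> unchanged, and write \<open>L = \<Sum>\<^sub>j a\<^sub>j M\<^sub>j\<close> with distinct \<open>a\<^sub>j\<close>. Modulo \<open>L\<close> the points \<open>M\<^sub>j\<close> lie on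
  the curve \<open>\<gamma>(t) = \<Sum>\<^sub>j M\<^sub>j / (t - a\<^sub>j)\<close>. Consider the coefficient of \<open>1/t\<close> at infinity of
  \<open>\<gamma>(t)\<^sup>6 \<Prod>\<^sub>j (t - a\<^sub>j)\<^sup>2\<close>. In the expansion of the sixth power, a product in which no index occurs three
  times is a polynomial in \<open>t\<close> after multiplication by \<open>\<Prod>\<^sub>j (t - a\<^sub>j)\<^sup>2\<close> and contributes nothing, so the
  coefficient lies in \<open>I\<close> (\<open>curve_power_degree\<close>). On the other hand \<open>\<gamma>(t) = L/t\<^sup>2 + m\<^sub>2/t\<^sup>3 + \<dots>\<close> with
  \<open>m\<^sub>2 = \<Sum>\<^sub>j a\<^sub>j\<^sup>2 M\<^sub>j\<close>, and since the exponent of \<open>1/t\<close> that has to be reached is small, every term of the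
  coefficient contains a factor \<open>L\<close>. So the coefficient is \<open>L f\<close> for a form \<open>f\<close> of degree 5 with
  \<open>L f \<in> I\<close> (\<open>linear_times_cofactor_mem\<close>).

  Modulo \<open>L\<close> the form \<open>f\<close> is \<open>6 m\<^sub>2\<^sup>5\<close> (\<open>cofactor_mod_linear\<close>). To see that it is not in \<open>I\<close>, pair it with a
  product of five points of the dual space, each of which is a zero of \<open>L\<close> and of all but three
  of the \<open>M\<^sub>j\<close>, arranged so that every \<open>M\<^sub>j\<close> is nonzero at no more than two of the five points. The
  pairing kills \<open>I\<close> and \<open>L\<close>, and on \<open>m\<^sub>2\<^sup>5\<close> it is a nonzero multiple of a product of Vandermonde determinants
  (\<open>separating_ideal\<close>).

  Surjectivity would mean that the eight cubes generate all forms of degree 6 in the six variables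
  left by \<open>L = 0\<close>; but \<open>8 \<cdot> 56 < 462\<close> (\<open>not_all_forms_generated\<close>). Finally, by Cramer's rule the
  position required of the forms, and then of \<open>L\<close>, is a nonempty Zariski open condition.
\<close>

section \<open>Powers of a rational curve modulo cubes\<close>

definition geometric_fps :: "'r::comm_ring_1 \<Rightarrow> 'r fps" where
  "geometric_fps a = Abs_fps (\<lambda>n. a ^ n)"

definition linear_fps :: "'r::comm_ring_1 \<Rightarrow> 'r fps" where
  "linear_fps a = 1 - fps_const a * fps_X"

lemma linear_fps_mult_nth:
  "fps_nth (linear_fps a * F) n = fps_nth F n - (if n = 0 then 0 else a * fps_nth F (n - 1))"
  by (simp add: linear_fps_def left_diff_distrib mult.assoc)

lemma linear_fps_geometric: "linear_fps a * geometric_fps a = 1"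
  by (rule fps_ext) (auto simp: linear_fps_mult_nth geometric_fps_def simp flip: power_Suc)

text \<open>
  Ideals in the sense of the type classes, so that power series over the polynomial ring and ring
  operations written without carriers can be used; \<open>ideal_iff_closed_ideal\<close> identifies them with
  the carrier-based ideals.
\<close>

definition closed_ideal :: "'r::comm_ring_1 set \<Rightarrow> bool" where
  "closed_ideal I \<longleftrightarrow> 0 \<in> I \<and> (\<forall>x\<in>I. \<forall>y\<in>I. x + y \<in> I) \<and> (\<forall>x\<in>I. \<forall>q. q * x \<in> I)"

lemma closed_idealD:
  assumes "closed_ideal I"
  shows "0 \<in> I" "x \<in> I \<Longrightarrow> y \<in> I \<Longrightarrow> x + y \<in> I" "x \<in> I \<Longrightarrow> q * x \<in> I"
  using assms by (auto simp: closed_ideal_def)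

lemma closed_ideal_mult_right: "closed_ideal I \<Longrightarrow> x \<in> I \<Longrightarrow> x * q \<in> I"
  using closed_idealD(3)[of I x q] by (simp add: mult.commute)

lemma closed_ideal_diff: "closed_ideal I \<Longrightarrow> x \<in> I \<Longrightarrow> y \<in> I \<Longrightarrow> x - y \<in> I"
  using closed_idealD(2)[of I x "- 1 * y"] closed_idealD(3)[of I y "- 1"] by simp

lemma closed_ideal_sum:
  "closed_ideal I \<Longrightarrow> (\<And>i. i \<in> A \<Longrightarrow> f i \<in> I) \<Longrightarrow> sum f A \<in> I"
  by (induction A rule: infinite_finite_induct) (auto intro: closed_idealD)

text \<open>
  Modulo \<open>I\<close> the series is a polynomial of degree at most \<open>N\<close>. The bound is an integer because
  high powers of the curve below lead to negative bounds, where it says that all coefficients lie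
  in \<open>I\<close>.
\<close>

definition degree_le_mod :: "'r::comm_ring_1 set \<Rightarrow> int \<Rightarrow> 'r fps \<Rightarrow> bool" where
  "degree_le_mod I N F \<longleftrightarrow> (\<forall>l. int l > N \<longrightarrow> fps_nth F l \<in> I)"

lemma degree_le_mod_linear:
  assumes "closed_ideal I" "degree_le_mod I N F"
  shows "degree_le_mod I (N + 1) (linear_fps a * F)"
  using assms by (auto simp: degree_le_mod_def linear_fps_mult_nth closed_idealD
      intro!: closed_ideal_diff closed_idealD)

lemma degree_le_mod_const:
  assumes "closed_ideal I" "degree_le_mod I N F"
  shows "degree_le_mod I N (fps_const c * F)"
  using assms by (auto simp: degree_le_mod_def closed_idealD)

lemma degree_le_mod_const_mem:
  assumes "closed_ideal I" "c \<in> I"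
  shows "degree_le_mod I N (fps_const c * F)"
  using assms by (auto simp: degree_le_mod_def closed_ideal_mult_right)

lemma degree_le_mod_sum:
  assumes "closed_ideal I" "\<And>i. i \<in> A \<Longrightarrow> degree_le_mod I N (F i)"
  shows "degree_le_mod I N (sum F A)"
  using assms by (auto simp: degree_le_mod_def fps_sum_nth intro!: closed_ideal_sum)

text \<open>
  With \<open>X = 1/t\<close> this is \<open>t\<close> times the expansion at infinity of \<open>\<gamma>(t) = \<Sum>\<^sub>j M\<^sub>j / (t - a\<^sub>j)\<close>, the
  parametrised rational normal curve through the points \<open>M\<^sub>j\<close>.
\<close>

definition curve_fps :: "'j set \<Rightarrow> ('j \<Rightarrow> 'r::comm_ring_1) \<Rightarrow> ('j \<Rightarrow> 'r) \<Rightarrow> 'r fps" where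
  "curve_fps J M a = (\<Sum>j\<in>J. fps_const (M j) * geometric_fps (a j))"

lemma curve_fps_nth: "fps_nth (curve_fps J M a) n = (\<Sum>j\<in>J. M j * a j ^ n)"
  by (simp add: curve_fps_def fps_sum_nth geometric_fps_def)

text \<open>
  In the expansion of the \<open>n\<close>-th power, a product of \<open>M\<^sub>j/(1 - a\<^sub>j X)\<close> in which no index occurs
  three times has all its denominators cleared by the factors \<open>(1 - a\<^sub>j X)\<^sup>2\<close>, and is a polynomial
  of degree at most \<open>2 |J| - n\<close>; any other product is divisible by some \<open>M\<^sub>j\<^sup>3\<close>. Adding one index at a
  time avoids the multinomial expansion.
\<close>

lemma curve_power_degree:
  fixes M a :: "'j \<Rightarrow> 'r::comm_ring_1"
  assumes "finite J" and I: "closed_ideal I" and cube: "\<And>j. j \<in> J \<Longrightarrow> M j ^ 3 \<in> I"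
  shows "degree_le_mod I (2 * int (card J) - int n)
           (curve_fps J M a ^ n * (\<Prod>j\<in>J. linear_fps (a j) ^ 2))"
  using assms(1) cube
proof (induction J arbitrary: n rule: finite_induct)
  case empty
  then show ?case
    using I by (cases "n = 0") (auto simp: degree_le_mod_def curve_fps_def closed_idealD zero_power)
next
  case (insert i J)
  define c where "c = fps_const (M i)"
  define G where "G = geometric_fps (a i)"
  define u where "u = linear_fps (a i)"
  define S where "S = curve_fps J M a"
  define W where "W = (\<Prod>j\<in>J. linear_fps (a j) ^ 2)"
  let ?N = "2 * int (card (insert i J)) - int n"
  have uG: "u * G = 1" by (simp add: u_def G_def linear_fps_geometric)
  have IH: "degree_le_mod I (2 * int (card J) - int m) (S ^ m * W)" for m
    unfolding S_def W_def by (rule insert.IH) (use insert.prems in auto)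
  have summand: "degree_le_mod I ?N (of_nat (n choose k) * (c * G) ^ k * S ^ (n - k) * (u\<^sup>2 * W))"
    if "k \<le> n" for k
  proof -
    have "degree_le_mod I ?N ((c * G) ^ k * u\<^sup>2 * (S ^ (n - k) * W))"
    proof -
      consider "k = 0" | "k = 1" | "k = 2" | "k \<ge> 3" by linarith
      then show ?thesis
      proof cases
        case 1
        have "degree_le_mod I (2 * int (card J) - int n + 1 + 1) (u * (u * (S ^ n * W)))"
          unfolding u_def by (intro degree_le_mod_linear I IH)
        then show ?thesis
          using 1 insert.hyps by (simp add: power2_eq_square mult.assoc algebra_simps)
      next
        case 2
        have "(c * G) ^ k * u\<^sup>2 * (S ^ (n - k) * W) = (u * G) * (c * (u * (S ^ (n - 1) * W)))"
          using 2 by (simp add: power2_eq_square mult_ac)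
        moreover have "degree_le_mod I (2 * int (card J) - int (n - 1) + 1) (c * (u * (S ^ (n - 1) * W)))"
          unfolding u_def c_def by (intro degree_le_mod_linear degree_le_mod_const I IH)
        moreover have "2 * int (card J) - int (n - 1) + 1 = ?N"
          using 2 that insert.hyps by (simp add: of_nat_diff)
        ultimately show ?thesis by (simp add: uG)
      next
        case 3
        have "(c * G) ^ k * u\<^sup>2 * (S ^ (n - k) * W) = (u * G)^2 * (c * (c * (S ^ (n - 2) * W)))"
          using 3 by (simp add: power2_eq_square mult_ac)
        moreover have "degree_le_mod I (2 * int (card J) - int (n - 2)) (c * (c * (S ^ (n - 2) * W)))"
          unfolding c_def by (intro degree_le_mod_const I IH)
        moreover have "2 * int (card J) - int (n - 2) = ?N"
          using 3 that insert.hyps by (simp add: of_nat_diff)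
        ultimately show ?thesis by (simp add: uG)
      next
        case 4
        then obtain r where k: "k = 3 + r" using le_Suc_ex by blast
        have "(c * G) ^ k * u\<^sup>2 * (S ^ (n - k) * W)
              = fps_const (M i ^ 3) * (c ^ r * G ^ k * u\<^sup>2 * (S ^ (n - k) * W))"
          by (simp add: k c_def power_mult_distrib power_add fps_const_power mult_ac flip: fps_const_mult)
        then show ?thesis
          using degree_le_mod_const_mem[OF I] insert.prems by auto
      qed
    qed
    then have "degree_le_mod I ?N (fps_const (of_nat (n choose k)) * ((c * G) ^ k * u\<^sup>2 * (S ^ (n - k) * W)))"
      by (rule degree_le_mod_const[OF I])
    then show ?thesis by (simp add: fps_of_nat mult_ac)
  qed
  have "curve_fps (insert i J) M a = c * G + S"
    using insert.hyps by (simp add: curve_fps_def c_def G_def S_def)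
  moreover have "(\<Prod>j\<in>insert i J. linear_fps (a j) ^ 2) = u\<^sup>2 * W"
    using insert.hyps by (simp add: u_def W_def)
  ultimately have "curve_fps (insert i J) M a ^ n * (\<Prod>j\<in>insert i J. linear_fps (a j) ^ 2)
        = (\<Sum>k\<le>n. of_nat (n choose k) * (c * G) ^ k * S ^ (n - k) * (u\<^sup>2 * W))"
    by (simp add: binomial_ring sum_distrib_right)
  with summand I show ?case by (auto intro!: degree_le_mod_sum)
qed

text \<open>
  Since \<open>\<Sum>\<^sub>j M\<^sub>j = 0\<close>, the curve is \<open>X T\<close> with \<open>T = L + X H\<close> and \<open>L = \<Sum>\<^sub>j a\<^sub>j M\<^sub>j\<close>, so that
  \<open>T\<^sup>6 = L K + (X H)\<^sup>6\<close> where \<open>K = \<Sum>\<^sub>p T\<^sup>p (X H)\<^sup>5\<^sup>-\<^sup>p\<close>. The last term does not contribute to the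
  coefficient of \<open>X\<^sup>5\<close>, so the coefficient of \<open>X\<^sup>5\<close> in \<open>T\<^sup>6 \<Prod>\<^sub>j (1 - a\<^sub>j X)\<^sup>2\<close> is \<open>L\<close> times the form
  defined here.
\<close>

definition cofactor :: "'j set \<Rightarrow> ('j \<Rightarrow> 'r::comm_ring_1) \<Rightarrow> ('j \<Rightarrow> 'r) \<Rightarrow> 'r" where
  "cofactor J M a =
     fps_nth ((\<Sum>p<6. fps_shift 1 (curve_fps J M a) ^ p
                  * (fps_X * fps_shift 2 (curve_fps J M a)) ^ (5 - p))
              * (\<Prod>j\<in>J. linear_fps (a j) ^ 2)) 5"

context
  fixes J :: "'j set" and M a :: "'j \<Rightarrow> 'r::comm_ring_1" and S T H W :: "'r fps" and L :: 'r
  assumes sum0: "(\<Sum>j\<in>J. M j) = 0"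
  defines "S \<equiv> curve_fps J M a" and "T \<equiv> fps_shift 1 (curve_fps J M a)"
    and "H \<equiv> fps_shift 2 (curve_fps J M a)" and "W \<equiv> (\<Prod>j\<in>J. linear_fps (a j) ^ 2)"
    and "L \<equiv> (\<Sum>j\<in>J. M j * a j)"
begin

lemma curve_eq: "S = fps_X * T"
  by (rule fps_ext) (auto simp: S_def T_def curve_fps_nth sum0)

lemma tail_eq: "T = fps_const L + fps_X * H"
proof (rule fps_ext)
  fix n
  show "fps_nth T n = fps_nth (fps_const L + fps_X * H) n"
    by (cases n) (simp_all add: T_def H_def L_def curve_fps_nth)
qed

text \<open>
  The coefficient of \<open>X\<^sup>1\<^sup>1\<close> in the sixth power of the curve, multiplied by the squares,
  lies just beyond the degree bound
  \<open>2 \<cdot> 8 - 6 = 10\<close> of \<open>curve_power_degree\<close>, hence in the ideal.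
\<close>

lemma linear_times_cofactor_mem:
  assumes "finite J" "card J = 8" "closed_ideal I" "\<And>j. j \<in> J \<Longrightarrow> M j ^ 3 \<in> I"
  shows "L * cofactor J M a \<in> I"
proof -
  let ?K = "\<Sum>p<6. T ^ p * (fps_X * H) ^ (5 - p)"
  have "T ^ 6 - (fps_X * H) ^ 6 = fps_const L * ?K"
    using diff_power_eq_sum[of T 5 "fps_X * H"] by (simp add: tail_eq eval_nat_numeral)
  then have "T ^ 6 = fps_const L * ?K + fps_X ^ 6 * H ^ 6"
    by (simp add: power_mult_distrib algebra_simps)
  then have "T ^ 6 * W = fps_const L * (?K * W) + fps_X ^ 6 * (H ^ 6 * W)"
    by (simp add: algebra_simps)
  then have "fps_nth (T ^ 6 * W) 5 = L * cofactor J M a"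
    by (simp add: fps_X_power_mult_nth cofactor_def T_def H_def W_def)
  moreover have "fps_nth (S ^ 6 * W) 11 = fps_nth (T ^ 6 * W) 5"
    by (simp add: curve_eq power_mult_distrib mult.assoc fps_X_power_mult_nth)
  moreover have "fps_nth (S ^ 6 * W) 11 \<in> I"
    using curve_power_degree[OF assms(1,3,4), where n = 6 and a = a] assms(2)
    unfolding degree_le_mod_def S_def W_def by simp
  ultimately show ?thesis by simp
qed

text \<open>
  Modulo \<open>L\<close> all six summands of \<open>K\<close> become \<open>(X H)\<^sup>5\<close>, and the constant coefficient of \<open>H\<close> is the
  second moment. This makes non-membership of the cofactor easy to test by a functional that
  kills \<open>L\<close> as well.
\<close>

lemma cofactor_mod_linear:
  "\<exists>g. cofactor J M a = 6 * (\<Sum>j\<in>J. M j * a j ^ 2) ^ 5 + L * g"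
proof -
  have "\<exists>q. T ^ p = (fps_X * H) ^ p + fps_const L * q" for p
  proof (induction p)
    case (Suc p)
    then obtain q where q: "T ^ p = (fps_X * H) ^ p + fps_const L * q" by blast
    have "T ^ Suc p = (fps_X * H) ^ Suc p + fps_const L * ((fps_X * H) ^ p + q * T)"
      by (simp add: q) (simp add: tail_eq algebra_simps)
    then show ?case by blast
  qed (auto intro: exI[of _ 0])
  then obtain q where q: "\<And>p. T ^ p = (fps_X * H) ^ p + fps_const L * q p" by metis
  let ?Q = "\<Sum>p<6. q p * (fps_X * H) ^ (5 - p)"
  have "(\<Sum>p<6. T ^ p * (fps_X * H) ^ (5 - p))
      = (\<Sum>p<6::nat. (fps_X * H) ^ 5 + fps_const L * (q p * (fps_X * H) ^ (5 - p)))"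
    by (rule sum.cong) (auto simp: q distrib_right mult.assoc simp flip: power_add)
  also have "\<dots> = 6 * (fps_X * H) ^ 5 + fps_const L * ?Q"
    by (simp add: sum.distrib sum_distrib_left)
  finally have "(\<Sum>p<6. T ^ p * (fps_X * H) ^ (5 - p)) * W
      = fps_X ^ 5 * (of_nat 6 * (H ^ 5 * W)) + fps_const L * (?Q * W)"
    by (simp add: power_mult_distrib algebra_simps)
  then have "cofactor J M a = fps_nth (of_nat 6 * (H ^ 5 * W)) 0 + L * fps_nth (?Q * W) 5"
    unfolding cofactor_def T_def[symmetric] H_def[symmetric] W_def[symmetric]
    by (simp add: fps_X_power_mult_nth)
  moreover have "fps_nth W 0 = 1"
    unfolding W_def by (induction J rule: infinite_finite_induct) (simp_all add: linear_fps_def power2_eq_square)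
  moreover have "fps_nth H 0 = (\<Sum>j\<in>J. M j * a j ^ 2)"
    by (simp add: H_def curve_fps_nth numeral_2_eq_2)
  ultimately show ?thesis by (auto simp: fps_power_zeroth)
qed

end

section \<open>Polynomials, homogeneous forms and polynomial functions\<close>

lemma mpoly_monomials: "p = (\<Sum>m\<in>Poly_Mapping.keys p. Poly_Mapping.single m (Poly_Mapping.lookup p m))"
  by (rule poly_mapping_eqI)
    (auto simp: lookup_sum lookup_single when_def in_keys_iff if_distrib sum.delta cong: if_cong)

definition mpoly_subst ::
    "(complex \<Rightarrow> 's::comm_ring_1) \<Rightarrow> ('n::finite \<Rightarrow> 's) \<Rightarrow> 'n mpoly \<Rightarrow> 's" where
  "mpoly_subst \<kappa> v p = (\<Sum>m\<in>Poly_Mapping.keys p.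
     \<kappa> (Poly_Mapping.lookup p m) * (\<Prod>i\<in>UNIV. v i ^ Poly_Mapping.lookup m i))"

lemma mpoly_eval_eq_subst: "mpoly_eval p v = mpoly_subst id v p"
  by (simp add: mpoly_eval_def mpoly_subst_def)

text \<open>
  The ring homomorphisms from the polynomial ring used below differ in their targets: the complex
  numbers, a polynomial ring in marker variables, and power series over the polynomial ring
  itself. They share this description by the images of the constants and of the variables.
\<close>

locale coefficient_hom =
  fixes \<kappa> :: "complex \<Rightarrow> 's::comm_ring_1"
  assumes coeff_add: "\<kappa> (x + y) = \<kappa> x + \<kappa> y" and coeff_mult: "\<kappa> (x * y) = \<kappa> x * \<kappa> y"
    and coeff_one: "\<kappa> 1 = 1"
begin

lemma coeff_zero [simp]: "\<kappa> 0 = 0"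
  using coeff_add[of 0 0] by simp

lemma subst_single: "mpoly_subst \<kappa> v (Poly_Mapping.single m c) = \<kappa> c * (\<Prod>i\<in>UNIV. v i ^ Poly_Mapping.lookup m i)"
  by (simp add: mpoly_subst_def)

lemma subst_zero [simp]: "mpoly_subst \<kappa> v 0 = 0"
  by (simp add: mpoly_subst_def)

lemma subst_add: "mpoly_subst \<kappa> v (p + q) = mpoly_subst \<kappa> v p + mpoly_subst \<kappa> v q"
  unfolding mpoly_subst_def
  by (rule setsum_keys_plus_distrib) (simp_all add: coeff_add distrib_right)

lemma subst_sum: "mpoly_subst \<kappa> v (sum f A) = (\<Sum>x\<in>A. mpoly_subst \<kappa> v (f x))"
  by (induction A rule: infinite_finite_induct) (simp_all add: subst_add)

lemma subst_mult: "mpoly_subst \<kappa> v (p * q) = mpoly_subst \<kappa> v p * mpoly_subst \<kappa> v q"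
proof -
  let ?s = "\<lambda>p m. Poly_Mapping.single m (Poly_Mapping.lookup p m)"
  have "p * q = (\<Sum>m\<in>Poly_Mapping.keys p. \<Sum>n\<in>Poly_Mapping.keys q. ?s p m * ?s q n)"
    by (subst (1) mpoly_monomials[of p], subst (1) mpoly_monomials[of q]) (simp add: sum_product)
  then have "mpoly_subst \<kappa> v (p * q)
      = (\<Sum>m\<in>Poly_Mapping.keys p. \<Sum>n\<in>Poly_Mapping.keys q. mpoly_subst \<kappa> v (?s p m * ?s q n))"
    by (simp only: subst_sum)
  also have "\<dots> = mpoly_subst \<kappa> v p * mpoly_subst \<kappa> v q"
    unfolding mpoly_subst_def[of \<kappa> v p] mpoly_subst_def[of \<kappa> v q] sum_product
    by (simp add: mult_single subst_single coeff_mult lookup_add power_add prod.distrib mult_ac)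
  finally show ?thesis .
qed

lemma subst_one [simp]: "mpoly_subst \<kappa> v 1 = 1"
  using subst_single[of v 0 1] by (simp add: coeff_one)

lemma subst_power: "mpoly_subst \<kappa> v (p ^ n) = mpoly_subst \<kappa> v p ^ n"
  by (induction n) (simp_all add: subst_mult)

lemma subst_numeral: "mpoly_subst \<kappa> v (numeral n) = numeral n"
proof -
  have "mpoly_subst \<kappa> v (of_nat k) = of_nat k" for k
    by (induction k) (simp_all add: subst_add)
  from this[of "numeral n"] show ?thesis by simp
qed

lemma subst_lin_form: "mpoly_subst \<kappa> v (lin_form c) = (\<Sum>i\<in>UNIV. \<kappa> (c i) * v i)"
  by (simp add: lin_form_def subst_sum subst_single lookup_single when_def if_distrib[of "\<lambda>e. _ ^ e"]
      cong: if_cong)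

end

lemma coefficient_hom_id: "coefficient_hom (id :: complex \<Rightarrow> complex)"
  by unfold_locales simp_all

lemma homogeneous_zero: "0 \<in> homogeneous d"
  by (simp add: homogeneous_def)

lemma homogeneous_add: "p \<in> homogeneous d \<Longrightarrow> q \<in> homogeneous d \<Longrightarrow> p + q \<in> homogeneous d"
  using Poly_Mapping.keys_add[of p q] by (fastforce simp: homogeneous_def)

lemma homogeneous_uminus: "p \<in> homogeneous d \<Longrightarrow> - p \<in> homogeneous d"
  by (simp add: homogeneous_def in_keys_iff)

lemma homogeneous_sum: "(\<And>x. x \<in> A \<Longrightarrow> f x \<in> homogeneous d) \<Longrightarrow> sum f A \<in> homogeneous d"
  by (induction A rule: infinite_finite_induct) (simp_all add: homogeneous_zero homogeneous_add)

lemma homogeneous_mult: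
  "p \<in> homogeneous d \<Longrightarrow> q \<in> homogeneous e \<Longrightarrow> p * q \<in> homogeneous (d + e)"
  using keys_mult[of p q] by (fastforce simp: homogeneous_def lookup_add sum.distrib)

lemma homogeneous_single:
  "(\<Sum>i\<in>UNIV. Poly_Mapping.lookup m i) = d \<Longrightarrow> Poly_Mapping.single m c \<in> homogeneous d"
  by (simp add: homogeneous_def)

lemma homogeneous_const: "Poly_Mapping.single 0 c \<in> homogeneous 0"
  by (simp add: homogeneous_single)

lemma homogeneous_one: "1 \<in> homogeneous 0"
  by (simp add: homogeneous_def)

lemma homogeneous_lin_form: "lin_form c \<in> homogeneous 1"
  unfolding lin_form_def
  by (intro homogeneous_sum homogeneous_single) (simp add: lookup_single when_def)

definition polynomial_function :: "(('k::finite \<Rightarrow> complex) \<Rightarrow> complex) \<Rightarrow> bool" where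
  "polynomial_function P \<longleftrightarrow> (\<exists>p. \<forall>v. mpoly_eval p v = P v)"

lemma polynomial_function_const: "polynomial_function (\<lambda>v. c)"
  unfolding polynomial_function_def mpoly_eval_eq_subst
  by (rule exI[of _ "Poly_Mapping.single 0 c"])
     (simp add: coefficient_hom.subst_single[OF coefficient_hom_id])

lemma polynomial_function_coord: "polynomial_function (\<lambda>v. v i)"
  unfolding polynomial_function_def mpoly_eval_eq_subst
  by (rule exI[of _ "lin_form (\<lambda>j. if j = i then 1 else 0)"])
     (simp add: coefficient_hom.subst_lin_form[OF coefficient_hom_id] if_distrib[of "\<lambda>x. x * _"] cong: if_cong)

lemma polynomial_function_add:
  "polynomial_function P \<Longrightarrow> polynomial_function Q \<Longrightarrow> polynomial_function (\<lambda>v. P v + Q v)"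
  unfolding polynomial_function_def mpoly_eval_eq_subst
  by (metis coefficient_hom.subst_add[OF coefficient_hom_id])

lemma polynomial_function_mult:
  "polynomial_function P \<Longrightarrow> polynomial_function Q \<Longrightarrow> polynomial_function (\<lambda>v. P v * Q v)"
  unfolding polynomial_function_def mpoly_eval_eq_subst
  by (metis coefficient_hom.subst_mult[OF coefficient_hom_id])

lemma polynomial_function_sum:
  "(\<And>x. x \<in> A \<Longrightarrow> polynomial_function (P x)) \<Longrightarrow> polynomial_function (\<lambda>v. \<Sum>x\<in>A. P x v)"
  by (induction A rule: infinite_finite_induct)
     (simp_all add: polynomial_function_const polynomial_function_add)

lemma polynomial_function_prod:
  "(\<And>x. x \<in> A \<Longrightarrow> polynomial_function (P x)) \<Longrightarrow> polynomial_function (\<lambda>v. \<Prod>x\<in>A. P x v)"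
  by (induction A rule: infinite_finite_induct)
     (simp_all add: polynomial_function_const polynomial_function_mult)

lemma polynomial_function_diff:
  assumes "polynomial_function P" "polynomial_function Q"
  shows "polynomial_function (\<lambda>v. P v - Q v)"
  using polynomial_function_add[OF assms(1) polynomial_function_mult[OF polynomial_function_const[of "- 1"] assms(2)]]
  by simp

text \<open>
  A set where a single polynomial does not vanish is the only kind of open set needed.
\<close>

lemma holds_genericallyI:
  assumes "polynomial_function P" "P w \<noteq> 0" "\<And>v. P v \<noteq> 0 \<Longrightarrow> Q v"
  shows "holds_generically Q"
proof -
  obtain p where p: "\<And>v. mpoly_eval p v = P v" using assms(1) by (auto simp: polynomial_function_def)
  have "zariski_open {v. P v \<noteq> 0}"
    unfolding zariski_open_def zariski_closed_def
    by (rule exI[of _ "{p}"]) (auto simp: p)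
  then show ?thesis
    unfolding holds_generically_def using assms(2,3) by blast
qed

lemma fps_prod_coeff_homogeneous:
  assumes "\<And>k. fps_nth F k \<in> homogeneous d" "\<And>k. fps_nth G k \<in> homogeneous e"
  shows "fps_nth (F * G) k \<in> homogeneous (d + e)"
  unfolding fps_mult_nth by (intro homogeneous_sum homogeneous_mult assms)

lemma fps_power_coeff_homogeneous:
  assumes "\<And>k. fps_nth F k \<in> homogeneous d"
  shows "fps_nth (F ^ n) k \<in> homogeneous (n * d)"
proof (induction n arbitrary: k)
  case 0
  then show ?case by (simp add: homogeneous_zero homogeneous_one)
next
  case (Suc n)
  then show ?case using fps_prod_coeff_homogeneous[OF assms Suc] by simp
qed

lemma cofactor_homogeneous:
  fixes M :: "'j \<Rightarrow> 'n::finite mpoly"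
  assumes "finite J" "\<And>j. j \<in> J \<Longrightarrow> M j \<in> homogeneous 1"
    and "\<And>j. j \<in> J \<Longrightarrow> a j \<in> homogeneous 0"
  shows "cofactor J M a \<in> homogeneous 5"
proof -
  have one: "fps_nth 1 k \<in> (homogeneous 0 :: 'n mpoly set)" for k :: nat
    by (simp add: homogeneous_zero homogeneous_one)
  have apow: "a j ^ k \<in> homogeneous 0" if "j \<in> J" for j k
    by (induction k) (use homogeneous_one homogeneous_mult[OF assms(3)[OF that]] in auto)
  have S: "fps_nth (curve_fps J M a) k \<in> homogeneous 1" for k
    unfolding curve_fps_nth using homogeneous_mult[OF assms(2) apow] by (auto intro!: homogeneous_sum)
  have X: "fps_nth (fps_X * F) k \<in> homogeneous d"
    if "\<And>k. fps_nth F k \<in> homogeneous d" for F :: "'n mpoly fps" and k d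
    using that by (cases k) (simp_all add: homogeneous_zero)
  have u: "fps_nth (linear_fps (a j) ^ 2) k \<in> homogeneous 0" if "j \<in> J" for j k
  proof -
    have "fps_nth (linear_fps (a j)) k \<in> homogeneous 0" for k
      using linear_fps_mult_nth[of "a j" 1 k] homogeneous_uminus[OF assms(3)[OF that]]
      by (auto simp: homogeneous_zero homogeneous_one)
    from fps_power_coeff_homogeneous[OF this, of 2] show ?thesis by simp
  qed
  have "A \<subseteq> J \<Longrightarrow> fps_nth (\<Prod>j\<in>A. linear_fps (a j) ^ 2) k \<in> homogeneous 0" for A k
  proof (induction A arbitrary: k rule: infinite_finite_induct)
    case (insert j A)
    then show ?case using fps_prod_coeff_homogeneous[OF u, of j "prod _ A" 0] by auto
  qed (use one in auto)
  then have W: "fps_nth (\<Prod>j\<in>J. linear_fps (a j) ^ 2) k \<in> homogeneous 0" for k by simp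
  let ?A = "fps_shift 1 (curve_fps J M a)" and ?B = "fps_X * fps_shift 2 (curve_fps J M a)"
  have "fps_nth (\<Sum>p<6. ?A ^ p * ?B ^ (5 - p)) k \<in> homogeneous 5" for k
    unfolding fps_sum_nth
  proof (intro homogeneous_sum)
    fix p :: nat assume p: "p \<in> {..<6}"
    have "fps_nth ?A k \<in> homogeneous 1" for k using S by simp
    moreover have "fps_nth ?B k \<in> homogeneous 1" for k by (rule X) (use S in simp)
    ultimately have "fps_nth (?A ^ p * ?B ^ (5 - p)) k \<in> homogeneous (p * 1 + (5 - p) * 1)"
      by (intro fps_prod_coeff_homogeneous fps_power_coeff_homogeneous)
    then show "fps_nth (?A ^ p * ?B ^ (5 - p)) k \<in> homogeneous 5" using p by simp
  qed
  from fps_prod_coeff_homogeneous[OF this W, of 5] show ?thesis by (simp add: cofactor_def)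
qed

section \<open>A functional separating the cofactor from the ideal\<close>

text \<open>
  If all \<open>t\<^sub>r\<close> have square zero, a power of their sum with exponent \<open>|A|\<close> consists of the
  squarefree product only, and the next power vanishes. The first part gives the value of the
  test functional on the second moment, the second part makes it vanish on the cubes.
\<close>

lemma square_zero_power:
  fixes t :: "'i \<Rightarrow> 'r::comm_ring_1"
  assumes N: "closed_ideal N" and "finite A" "\<And>r. r \<in> A \<Longrightarrow> t r ^ 2 \<in> N"
  shows "(\<Sum>r\<in>A. t r) ^ Suc (card A) \<in> N
       \<and> (\<Sum>r\<in>A. t r) ^ card A - of_nat (fact (card A)) * (\<Prod>r\<in>A. t r) \<in> N"
  using assms(2,3)
proof (induction A rule: finite_induct)
  case (insert r A)
  define x where "x = (\<Sum>r\<in>A. t r)"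
  define k where "k = card A"
  define c where "c = (of_nat (fact k) :: 'r)"
  define P where "P = (\<Prod>r\<in>A. t r)"
  have xk: "x ^ Suc k \<in> N" and xP: "x ^ k - c * P \<in> N"
    using insert by (auto simp: x_def k_def P_def c_def)
  have tr: "t r ^ 2 \<in> N" using insert.prems by simp
  have expand: "\<exists>q. (t r + x) ^ Suc n = x ^ Suc n + of_nat (Suc n) * x ^ n * t r + q * t r ^ 2" for n
  proof (induction n)
    case 0 then show ?case by (auto intro: exI[of _ 0])
  next
    case (Suc n)
    then obtain q where "(t r + x) ^ Suc n = x ^ Suc n + of_nat (Suc n) * x ^ n * t r + q * t r ^ 2" by blast
    then have "(t r + x) ^ Suc (Suc n) = x ^ Suc (Suc n) + of_nat (Suc (Suc n)) * x ^ Suc n * t r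
        + (of_nat (Suc n) * x ^ n + q * (t r + x)) * t r ^ 2"
      by (simp only: power_Suc[of "t r + x" "Suc n"]) (simp add: algebra_simps power2_eq_square)
    then show ?case by blast
  qed
  obtain q1 where q1: "(t r + x) ^ Suc k = x ^ Suc k + of_nat (Suc k) * x ^ k * t r + q1 * t r ^ 2"
    using expand by blast
  obtain q2 where q2: "(t r + x) ^ Suc (Suc k)
      = x ^ Suc (Suc k) + of_nat (Suc (Suc k)) * x ^ Suc k * t r + q2 * t r ^ 2"
    using expand by blast
  have "(t r + x) ^ Suc (Suc k) = x * x ^ Suc k + of_nat (Suc (Suc k)) * t r * x ^ Suc k + q2 * t r ^ 2"
    unfolding q2 by (simp add: mult_ac)
  then have 1: "(t r + x) ^ Suc (Suc k) \<in> N"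
    using xk tr closed_idealD[OF N] by simp
  have "(t r + x) ^ Suc k - of_nat (Suc k) * c * (t r * P)
      = x ^ Suc k + of_nat (Suc k) * t r * (x ^ k - c * P) + q1 * t r ^ 2"
    unfolding q1 by (simp add: algebra_simps)
  then have 2: "(t r + x) ^ Suc k - of_nat (Suc k) * c * (t r * P) \<in> N"
    using xk xP tr closed_idealD[OF N] by simp
  have "of_nat (fact (Suc k)) = of_nat (Suc k) * c"
    by (simp only: c_def fact_Suc of_nat_mult of_nat_id)
  with 1 2 insert.hyps show ?case
    by (simp only: x_def k_def P_def card_insert_disjoint sum.insert prod.insert not_False_eq_True)
qed (auto intro: closed_idealD[OF N])

lemma triple_sum:
  fixes \<alpha> :: "nat \<Rightarrow> complex"
  assumes "finite J" "p \<in> J" "q \<in> J" "s \<in> J" "distinct [p, q, s]"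
  shows "(\<Sum>j\<in>J. (if j = p then \<alpha> q - \<alpha> s else if j = q then \<alpha> s - \<alpha> p
                  else if j = s then \<alpha> p - \<alpha> q else 0) * g j)
       = (\<alpha> q - \<alpha> s) * g p + (\<alpha> s - \<alpha> p) * g q + (\<alpha> p - \<alpha> q) * g s"
proof -
  have "(\<Sum>j\<in>J. (if j = p then \<alpha> q - \<alpha> s else if j = q then \<alpha> s - \<alpha> p
                  else if j = s then \<alpha> p - \<alpha> q else 0) * g j)
      = (\<Sum>j\<in>{p,q,s}. (if j = p then \<alpha> q - \<alpha> s else if j = q then \<alpha> s - \<alpha> p
                  else if j = s then \<alpha> p - \<alpha> q else 0) * g j)"
    by (rule sum.mono_neutral_right) (use assms in auto)
  then show ?thesis using assms(5) by auto
qed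

text \<open>
  Five triples of indices below 8 such that no index is in more than two of them.
\<close>

definition triple :: "nat \<Rightarrow> nat \<times> nat \<times> nat" where
  "triple r = [(0, 1, 2), (2, 3, 4), (4, 5, 6), (6, 7, 0), (1, 3, 5)] ! r"

text \<open>
  The relation among the points \<open>(1, \<alpha>\<^sub>p)\<close>, \<open>(1, \<alpha>\<^sub>q)\<close>, \<open>(1, \<alpha>\<^sub>s)\<close> of the plane: a vector supported on the
  triple and orthogonal to \<open>(1)\<^sub>j\<close> and \<open>(\<alpha>\<^sub>j)\<^sub>j\<close>. Its pairing with \<open>(\<alpha>\<^sub>j\<^sup>2)\<^sub>j\<close> is, up to sign, a Vandermonde
  determinant.
\<close>

definition triple_vector :: "(nat \<Rightarrow> complex) \<Rightarrow> nat \<times> nat \<times> nat \<Rightarrow> nat \<Rightarrow> complex" where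
  "triple_vector \<alpha> = (\<lambda>(p, q, s) j.
     if j = p then \<alpha> q - \<alpha> s else if j = q then \<alpha> s - \<alpha> p else if j = s then \<alpha> p - \<alpha> q else 0)"

lemma lt5_cases: "r < 5 \<Longrightarrow> r = 0 \<or> r = 1 \<or> r = 2 \<or> r = 3 \<or> r = (4::nat)" by linarith

lemma triple_cases:
  assumes "r < 5"
  obtains p q s where "triple r = (p, q, s)" "p < 8" "q < 8" "s < 8" "distinct [p, q, s]"
  using lt5_cases[OF assms] by (auto simp: triple_def)

lemma triple_vector_sum:
  assumes "r < 5"
  shows "(\<Sum>j<8. triple_vector \<alpha> (triple r) j) = 0"
    and "(\<Sum>j<8. triple_vector \<alpha> (triple r) j * \<alpha> j) = 0"
    and "inj_on \<alpha> {..<8} \<Longrightarrow> (\<Sum>j<8. triple_vector \<alpha> (triple r) j * \<alpha> j ^ 2) \<noteq> 0"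
proof -
  obtain p q s where t: "triple r = (p, q, s)" "p < 8" "q < 8" "s < 8" "distinct [p, q, s]"
    using triple_cases[OF assms] .
  have sum: "(\<Sum>j<8. triple_vector \<alpha> (triple r) j * g j)
      = (\<alpha> q - \<alpha> s) * g p + (\<alpha> s - \<alpha> p) * g q + (\<alpha> p - \<alpha> q) * g s" for g
    unfolding triple_vector_def t(1) prod.case using t by (intro triple_sum) auto
  show "(\<Sum>j<8. triple_vector \<alpha> (triple r) j) = 0" using sum[of "\<lambda>_. 1"] by simp
  show "(\<Sum>j<8. triple_vector \<alpha> (triple r) j * \<alpha> j) = 0"
    unfolding sum by (simp add: algebra_simps)
  assume "inj_on \<alpha> {..<8}"
  then have "\<alpha> p \<noteq> \<alpha> q" "\<alpha> q \<noteq> \<alpha> s" "\<alpha> s \<noteq> \<alpha> p"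
    using t by (auto simp: inj_on_def)
  moreover have "(\<Sum>j<8. triple_vector \<alpha> (triple r) j * \<alpha> j ^ 2)
      = - ((\<alpha> p - \<alpha> q) * (\<alpha> q - \<alpha> s) * (\<alpha> s - \<alpha> p))"
    unfolding sum by (simp add: algebra_simps power2_eq_square)
  ultimately show "(\<Sum>j<8. triple_vector \<alpha> (triple r) j * \<alpha> j ^ 2) \<noteq> 0" by simp
qed

lemma card_triples_through:
  assumes "j < 8"
  shows "card {r\<in>{..<5}. triple_vector \<alpha> (triple r) j \<noteq> 0} \<le> 2"
proof -
  have *: "{..<5::nat} = {0, 1, 2, 3, 4}" by auto
  have "j = 0 \<or> j = 1 \<or> j = 2 \<or> j = 3 \<or> j = 4 \<or> j = 5 \<or> j = 6 \<or> j = 7"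
    using assms by linarith
  then have "\<exists>r1 r2. {r\<in>{..<5}. triple_vector \<alpha> (triple r) j \<noteq> 0} \<subseteq> {r1, r2}"
    unfolding *
    apply (elim disjE)
           apply (rule exI[of _ 0], rule exI[of _ 3], force simp: triple_def triple_vector_def)
          apply (rule exI[of _ 0], rule exI[of _ 4], force simp: triple_def triple_vector_def)
         apply (rule exI[of _ 0], rule exI[of _ 1], force simp: triple_def triple_vector_def)
        apply (rule exI[of _ 1], rule exI[of _ 4], force simp: triple_def triple_vector_def)
       apply (rule exI[of _ 1], rule exI[of _ 2], force simp: triple_def triple_vector_def)
      apply (rule exI[of _ 2], rule exI[of _ 4], force simp: triple_def triple_vector_def)
     apply (rule exI[of _ 2], rule exI[of _ 3], force simp: triple_def triple_vector_def)
    apply (rule exI[of _ 3], rule exI[of _ 3], force simp: triple_def triple_vector_def)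
    done
  then obtain r1 r2 where "{r\<in>{..<5}. triple_vector \<alpha> (triple r) j \<noteq> 0} \<subseteq> {r1, r2}" by blast
  from card_mono[OF _ this] show ?thesis by (simp add: card_insert_if split: if_splits)
qed

type_synonym marker_poly = "(nat \<Rightarrow>\<^sub>0 nat) \<Rightarrow>\<^sub>0 complex"

definition marker :: "nat \<Rightarrow> marker_poly" where
  "marker r = Poly_Mapping.single (Poly_Mapping.single r 1) 1"

definition all_markers :: "nat \<Rightarrow>\<^sub>0 nat" where
  "all_markers = (\<Sum>r<5. Poly_Mapping.single r 1)"

text \<open>
  The largest ideal on which the coefficient of the product of the first five markers vanishes.
  It contains the squares of these markers, so it can replace the ideal that they generate, and
  non-membership can be read off from one coefficient.
\<close>

definition negligible_part :: "marker_poly set" where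
  "negligible_part = {p. \<forall>q. Poly_Mapping.lookup (q * p) all_markers = 0}"

lemma lookup_all_markers: "r < 5 \<Longrightarrow> Poly_Mapping.lookup all_markers r = 1"
  by (simp add: all_markers_def lookup_sum lookup_single when_def)

lemma closed_ideal_negligible: "closed_ideal negligible_part"
  by (auto simp: closed_ideal_def negligible_part_def distrib_left lookup_add simp flip: mult.assoc)

lemma marker_square: "r < 5 \<Longrightarrow> marker r ^ 2 \<in> negligible_part"
proof -
  assume r: "r < 5"
  have "all_markers \<notin> Poly_Mapping.keys (q * marker r ^ 2)" for q
  proof
    assume "all_markers \<in> Poly_Mapping.keys (q * marker r ^ 2)"
    then obtain a b where ab: "all_markers = a + b" "b \<in> Poly_Mapping.keys (marker r ^ 2)"
      using keys_mult[of q "marker r ^ 2"] by blast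
    have "b = Poly_Mapping.single r 2"
      using ab(2) by (simp add: marker_def power2_eq_square mult_single numeral_2_eq_2 flip: single_add)
    then have "Poly_Mapping.lookup all_markers r \<ge> 2"
      by (simp add: ab(1) lookup_add)
    then show False using r by (simp add: lookup_all_markers)
  qed
  then show ?thesis by (simp add: negligible_part_def in_keys_iff)
qed

lemma marker_prod: "c \<noteq> 0 \<Longrightarrow> Poly_Mapping.single 0 c * (\<Prod>r<5. marker r) \<notin> negligible_part"
proof -
  assume c: "c \<noteq> 0"
  have "(\<Prod>r\<in>A. marker r) = Poly_Mapping.single (\<Sum>r\<in>A. Poly_Mapping.single r 1) 1" for A
    by (induction A rule: infinite_finite_induct) (simp_all add: marker_def mult_single)
  then have "Poly_Mapping.lookup (1 * (Poly_Mapping.single 0 c * (\<Prod>r<5. marker r))) all_markers = c"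
    by (simp add: mult_single all_markers_def)
  with c show ?thesis unfolding negligible_part_def mem_Collect_eq by metis
qed

text \<open>
  Substituting \<open>x = \<Sum>\<^sub>r s\<^sub>r w\<^sub>r\<close> and taking the coefficient of \<open>s\<^sub>0 s\<^sub>1 s\<^sub>2 s\<^sub>3 s\<^sub>4\<close> pairs a polynomial with the
  product of the five points \<open>w\<^sub>r\<close> of the dual space. If \<open>w\<^sub>r\<close> takes the values of a triple vector
  on the forms \<open>M\<^sub>j\<close>, each \<open>M\<^sub>j\<close> becomes a combination of at most two markers, so that its cube
  is negligible; \<open>\<Sum>\<^sub>j a\<^sub>j M\<^sub>j\<close> becomes zero; and the fifth power of the second moment becomes a nonzero
  multiple of the product of the markers.
\<close>

lemma separating_ideal:
  fixes b :: "nat \<Rightarrow> 'n::finite \<Rightarrow> complex" and \<alpha> :: "nat \<Rightarrow> complex"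
  defines "M \<equiv> \<lambda>j. lin_form (b j)" and "a \<equiv> \<lambda>j. Poly_Mapping.single 0 (\<alpha> j)"
  assumes inj: "inj_on \<alpha> {..<8}"
    and dual: "\<And>y. (\<Sum>j<8. y j) = 0 \<Longrightarrow> \<exists>v. \<forall>j<8. mpoly_eval (M j) v = y j"
  shows "\<exists>I. closed_ideal I \<and> (\<forall>j<8. M j ^ 3 \<in> I) \<and> (\<Sum>j<8. M j * a j) \<in> I
      \<and> 6 * (\<Sum>j<8. M j * a j ^ 2) ^ 5 \<notin> I"
proof -
  let ?y = "\<lambda>r. triple_vector \<alpha> (triple r)"
  obtain w where w: "\<And>r j. r < 5 \<Longrightarrow> j < 8 \<Longrightarrow> mpoly_eval (M j) (w r) = ?y r j"
  proof -
    have "\<forall>r. \<exists>v. r < 5 \<longrightarrow> (\<forall>j<8. mpoly_eval (M j) v = ?y r j)"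
      using dual triple_vector_sum(1) by blast
    then show ?thesis using that by metis
  qed
  define \<kappa> :: "complex \<Rightarrow> marker_poly" where "\<kappa> = Poly_Mapping.single 0"
  interpret coefficient_hom \<kappa>
    by unfold_locales (simp_all add: \<kappa>_def single_add mult_single)
  \<comment> \<open>the images of the variables are the coordinates of the generic combination of the \<open>w r\<close>\<close>
  define \<rho> where "\<rho> = mpoly_subst \<kappa> (\<lambda>i. \<Sum>r<5. \<kappa> (w r i) * marker r)"
  have coeff_sum: "\<kappa> (sum f A) = (\<Sum>x\<in>A. \<kappa> (f x))" for f :: "'z \<Rightarrow> complex" and A
    by (induction A rule: infinite_finite_induct) (simp_all add: coeff_add)
  have coeff_prod: "\<kappa> (prod f A) = (\<Prod>x\<in>A. \<kappa> (f x))" for f :: "'z \<Rightarrow> complex" and A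
    by (induction A rule: infinite_finite_induct) (simp_all add: coeff_mult coeff_one)
  have M: "\<rho> (M j) = (\<Sum>r<5. \<kappa> (?y r j) * marker r)" if "j < 8" for j
  proof -
    have "\<rho> (M j) = (\<Sum>i\<in>UNIV. \<Sum>r<5. \<kappa> (b j i * w r i) * marker r)"
      by (simp add: \<rho>_def M_def subst_lin_form sum_distrib_left coeff_mult mult.assoc)
    also have "\<dots> = (\<Sum>r<5. \<kappa> (\<Sum>i\<in>UNIV. b j i * w r i) * marker r)"
      by (subst sum.swap) (simp add: coeff_sum sum_distrib_right)
    also have "\<dots> = (\<Sum>r<5. \<kappa> (mpoly_eval (M j) (w r)) * marker r)"
      by (simp add: M_def mpoly_eval_eq_subst coefficient_hom.subst_lin_form[OF coefficient_hom_id])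
    finally show ?thesis using w that by simp
  qed
  have \<rho>a: "\<rho> (a j) = \<kappa> (\<alpha> j)" for j by (simp add: \<rho>_def a_def subst_single)
  have moment: "\<rho> (\<Sum>j<8. M j * a j ^ k) = (\<Sum>r<5. \<kappa> (\<Sum>j<8. ?y r j * \<alpha> j ^ k) * marker r)" for k
  proof -
    have "\<kappa> x ^ k = \<kappa> (x ^ k)" for x by (induction k) (simp_all add: coeff_one coeff_mult)
    then have "\<rho> (\<Sum>j<8. M j * a j ^ k) = (\<Sum>j<8. \<rho> (M j) * \<kappa> (\<alpha> j ^ k))"
      by (simp add: \<rho>_def subst_sum subst_mult subst_power \<rho>a[unfolded \<rho>_def])
    also have "\<dots> = (\<Sum>j<8. \<Sum>r<5. \<kappa> (?y r j * \<alpha> j ^ k) * marker r)"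
      by (simp add: M sum_distrib_right sum_distrib_left coeff_mult mult_ac)
    also have "\<dots> = (\<Sum>r<5. \<kappa> (\<Sum>j<8. ?y r j * \<alpha> j ^ k) * marker r)"
      by (subst sum.swap) (simp add: coeff_sum sum_distrib_right)
    finally show ?thesis .
  qed
  define I where "I = {p. \<rho> p \<in> negligible_part}"
  note N = closed_idealD[OF closed_ideal_negligible]
  have sq: "(\<kappa> x * marker r) ^ 2 \<in> negligible_part" if "r < 5" for x r
    using N(3)[OF marker_square[OF that]] by (simp add: power_mult_distrib)
  have "closed_ideal I"
    by (auto simp: closed_ideal_def I_def \<rho>_def subst_add subst_mult N)
  moreover have "M j ^ 3 \<in> I" if j: "j < 8" for j
  proof -
    let ?A = "{r\<in>{..<5}. ?y r j \<noteq> 0}"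
    have "\<rho> (M j) = (\<Sum>r\<in>?A. \<kappa> (?y r j) * marker r)"
      unfolding M[OF j] by (rule sum.mono_neutral_right) auto
    moreover have "(\<Sum>r\<in>?A. \<kappa> (?y r j) * marker r) ^ Suc (card ?A) \<in> negligible_part"
      using square_zero_power[OF closed_ideal_negligible, of ?A "\<lambda>r. \<kappa> (?y r j) * marker r"] sq
      by auto
    ultimately have "\<rho> (M j) ^ Suc (card ?A) \<in> negligible_part" by simp
    moreover have "\<rho> (M j) ^ 3 = \<rho> (M j) ^ (2 - card ?A) * \<rho> (M j) ^ Suc (card ?A)"
      using card_triples_through[OF j, of \<alpha>] by (simp flip: power_add add: numeral_3_eq_3 numeral_2_eq_2)
    ultimately show ?thesis
      using N(3) by (simp add: I_def \<rho>_def subst_power)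
  qed
  moreover have "(\<Sum>j<8. M j * a j) \<in> I"
    using moment[of 1] triple_vector_sum(2) N(1) by (simp add: I_def)
  moreover have "6 * (\<Sum>j<8. M j * a j ^ 2) ^ 5 \<notin> I"
  proof
    define \<mu> where "\<mu> r = (\<Sum>j<8. ?y r j * \<alpha> j ^ 2)" for r
    define t where "t r = \<kappa> (\<mu> r) * marker r" for r
    assume "6 * (\<Sum>j<8. M j * a j ^ 2) ^ 5 \<in> I"
    then have "6 * (\<Sum>r<5. t r) ^ 5 \<in> negligible_part"
      using moment[of 2] by (simp add: I_def \<rho>_def subst_mult subst_power subst_numeral t_def \<mu>_def)
    moreover have "(\<Sum>r<5. t r) ^ 5 - 120 * (\<Prod>r<5. t r) \<in> negligible_part"
      using square_zero_power[OF closed_ideal_negligible, of "{..<5}" t] sq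
      by (simp add: t_def fact_numeral)
    then have "6 * ((\<Sum>r<5. t r) ^ 5 - 120 * (\<Prod>r<5. t r)) \<in> negligible_part" by (rule N(3))
    ultimately have "6 * (\<Sum>r<5. t r) ^ 5 - 6 * ((\<Sum>r<5. t r) ^ 5 - 120 * (\<Prod>r<5. t r)) \<in> negligible_part"
      by (rule closed_ideal_diff[OF closed_ideal_negligible])
    moreover have "6 * (\<Sum>r<5. t r) ^ 5 - 6 * ((\<Sum>r<5. t r) ^ 5 - 120 * (\<Prod>r<5. t r))
        = \<kappa> (720 * (\<Prod>r<5. \<mu> r)) * (\<Prod>r<5. marker r)"
    proof -
      have "\<kappa> 720 = 720" by (simp add: \<kappa>_def)
      then show ?thesis by (simp add: t_def prod.distrib coeff_mult coeff_prod algebra_simps)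
    qed
    moreover have "720 * (\<Prod>r<5. \<mu> r) \<noteq> 0"
      using triple_vector_sum(3)[OF _ inj] by (simp add: \<mu>_def)
    ultimately show False using marker_prod by (simp add: \<kappa>_def)
  qed
  ultimately show ?thesis by blast
qed

section \<open>Forms of degree six modulo a linear form\<close>

text \<open>
  Monomials of degree \<open>d\<close> in the variables other than \<open>i0\<close>. They are a basis of the forms of degree
  \<open>d\<close> modulo a linear form in which \<open>x\<^sub>i\<^sub>0\<close> occurs.
\<close>

definition monomials_avoiding :: "'n::finite \<Rightarrow> nat \<Rightarrow> ('n \<Rightarrow>\<^sub>0 nat) set" where
  "monomials_avoiding i0 d =
     {m. Poly_Mapping.lookup m i0 = 0 \<and> (\<Sum>i\<in>UNIV. Poly_Mapping.lookup m i) = d}"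

lemma finite_card_monomials_avoiding:
  fixes i0 :: "'n::finite"
  shows "finite (monomials_avoiding i0 d)"
    and "card (monomials_avoiding i0 d) = (d + (CARD('n) - 1) - 1) choose d"
proof -
  let ?n = "CARD('n) - 1"
  have "card {..<?n} = card (UNIV - {i0})" by simp
  then obtain e where e: "bij_betw e {..<?n} (UNIV - {i0})"
    by (meson finite finite_lessThan finite_same_card_bij)
  define e' where "e' = inv_into {..<?n} e"
  have e'e: "e' (e k) = k" if "k < ?n" for k
    using e that by (simp add: e'_def bij_betw_def)
  have ee': "e (e' i) = i" "e' i < ?n" if "i \<noteq> i0" for i
    using e that bij_betw_inv_into_right[OF e] bij_betwE[OF bij_betw_inv_into[OF e]]
    by (auto simp: e'_def)
  from ee' have ee'_Suc: "e' i < CARD('n) - Suc 0" if "i \<noteq> i0" for i using that by simp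
  have ei0: "e k \<noteq> i0" if "k < ?n" for k using bij_betwE[OF e] that by auto
  let ?L = "{l :: nat list. length l = ?n \<and> sum_list l = d}"
  let ?f = "\<lambda>m. map (\<lambda>k. Poly_Mapping.lookup m (e k)) [0..<?n]"
  let ?g = "\<lambda>l. Abs_poly_mapping (\<lambda>i. if i = i0 then 0 else l ! e' i) :: 'n \<Rightarrow>\<^sub>0 nat"
  have lookup_g: "Poly_Mapping.lookup (?g l) i = (if i = i0 then 0 else l ! e' i)" for l i
    by (subst lookup_Abs_poly_mapping) simp_all
  have sum_split: "(\<Sum>i\<in>UNIV. h i) = h i0 + (\<Sum>k<?n. h (e k))" for h :: "'n \<Rightarrow> nat"
  proof -
    have "(\<Sum>i\<in>UNIV. h i) = h i0 + (\<Sum>i\<in>UNIV - {i0}. h i)" by (simp add: sum.remove)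
    then show ?thesis using sum.reindex_bij_betw[OF e, of h] by simp
  qed
  have bij: "bij_betw ?f (monomials_avoiding i0 d) ?L"
  proof (rule bij_betw_byWitness[where f' = ?g])
    show "\<forall>m\<in>monomials_avoiding i0 d. ?g (?f m) = m"
      by (auto intro!: poly_mapping_eqI simp: lookup_g ee' ee'_Suc monomials_avoiding_def)
    show "\<forall>l\<in>?L. ?f (?g l) = l"
      by (auto intro!: nth_equalityI simp: lookup_g e'e ei0)
    show "?f ` monomials_avoiding i0 d \<subseteq> ?L"
      by (auto simp: monomials_avoiding_def sum_split interv_sum_list_conv_sum_set_nat atLeast0LessThan)
    show "?g ` ?L \<subseteq> monomials_avoiding i0 d"
      by (auto simp: monomials_avoiding_def sum_split lookup_g ei0 e'e sum_list_sum_nth atLeast0LessThan)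
  qed
  have "?L \<subseteq> {l. set l \<subseteq> {..d} \<and> length l = ?n}" using member_le_sum_list by auto
  moreover have "finite {l. set l \<subseteq> {..d} \<and> length l = ?n}" by (rule finite_lists_length_eq) simp
  ultimately have "finite ?L" by (rule finite_subset)
  with bij_betw_finite[OF bij] show "finite (monomials_avoiding i0 d)" by (rule iffD2)
  show "card (monomials_avoiding i0 d) = (d + (CARD('n) - 1) - 1) choose d"
    using bij_betw_same_card[OF bij] unfolding card_length_sum_list .
qed

definition scale_mpoly :: "complex \<Rightarrow> 'n::finite mpoly \<Rightarrow> 'n mpoly" where
  "scale_mpoly c p = Poly_Mapping.single 0 c * p"

interpretation mpoly_vs: vector_space scale_mpoly
  by unfold_locales (simp_all add: scale_mpoly_def distrib_left distrib_right single_add mult_single flip: mult.assoc)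

lemma single_one_eq_iff [simp]:
  "Poly_Mapping.single k (1 :: complex) = Poly_Mapping.single m 1 \<longleftrightarrow> k = m"
  by (metis lookup_single_eq lookup_single_not_eq zero_neq_one)

lemma independent_monomials:
  "mpoly_vs.independent ((\<lambda>m. Poly_Mapping.single m 1) ` A)"
proof -
  have "\<not> mpoly_vs.dependent ((\<lambda>m. Poly_Mapping.single m 1) ` A)"
  proof
    assume "mpoly_vs.dependent ((\<lambda>m. Poly_Mapping.single m 1) ` A)"
    then obtain t u v where t: "finite t" "t \<subseteq> (\<lambda>m. Poly_Mapping.single m 1) ` A"
      and s: "(\<Sum>v\<in>t. scale_mpoly (u v) v) = 0" and v: "v \<in> t" "u v \<noteq> 0"
      unfolding mpoly_vs.dependent_explicit by blast
    obtain m where m: "v = Poly_Mapping.single m 1" using t v by blast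
    have "Poly_Mapping.lookup (\<Sum>v\<in>t. scale_mpoly (u v) v) m = (\<Sum>w\<in>t. if w = v then u v else 0)"
      unfolding lookup_sum
    proof (rule sum.cong)
      fix w assume "w \<in> t"
      then obtain k where "w = Poly_Mapping.single k 1" using t by blast
      then show "Poly_Mapping.lookup (scale_mpoly (u w) w) m = (if w = v then u v else 0)"
        by (auto simp: scale_mpoly_def mult_single lookup_single m when_def)
    qed simp
    also have "\<dots> = u v" using t v by simp
    finally show False using s v by simp
  qed
  then show ?thesis .
qed

definition forms_avoiding :: "'n::finite \<Rightarrow> nat \<Rightarrow> 'n mpoly set" where
  "forms_avoiding i0 d = {p. Poly_Mapping.keys p \<subseteq> monomials_avoiding i0 d}"

lemma forms_avoiding_closed:
  "0 \<in> forms_avoiding i0 d"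
  "1 \<in> forms_avoiding i0 0"
  "p \<in> forms_avoiding i0 d \<Longrightarrow> q \<in> forms_avoiding i0 d \<Longrightarrow> p + q \<in> forms_avoiding i0 d"
  "p \<in> forms_avoiding i0 d \<Longrightarrow> q \<in> forms_avoiding i0 e \<Longrightarrow> p * q \<in> forms_avoiding i0 (d + e)"
proof -
  show "0 \<in> forms_avoiding i0 d" "1 \<in> forms_avoiding i0 0"
    by (simp_all add: forms_avoiding_def monomials_avoiding_def)
  show "p + q \<in> forms_avoiding i0 d" if "p \<in> forms_avoiding i0 d" "q \<in> forms_avoiding i0 d"
    using Poly_Mapping.keys_add[of p q] that unfolding forms_avoiding_def by blast
  show "p * q \<in> forms_avoiding i0 (d + e)" if "p \<in> forms_avoiding i0 d" "q \<in> forms_avoiding i0 e"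
  proof -
    have "x + y \<in> monomials_avoiding i0 (d + e)"
      if "x \<in> monomials_avoiding i0 d" "y \<in> monomials_avoiding i0 e" for x y
      using that by (simp add: monomials_avoiding_def lookup_add sum.distrib)
    then show ?thesis using keys_mult[of p q] that unfolding forms_avoiding_def by blast
  qed
qed

lemma forms_avoiding_sum:
  "(\<And>x. x \<in> A \<Longrightarrow> f x \<in> forms_avoiding i0 d) \<Longrightarrow> sum f A \<in> forms_avoiding i0 d"
  by (induction A rule: infinite_finite_induct) (simp_all add: forms_avoiding_closed)

lemma forms_avoiding_power:
  "p \<in> forms_avoiding i0 1 \<Longrightarrow> p ^ n \<in> forms_avoiding i0 n"
  using forms_avoiding_closed(4)[of p i0 1] by (induction n) (auto simp: forms_avoiding_closed(2))

lemma forms_avoiding_prod: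
  "(\<And>x. x \<in> A \<Longrightarrow> f x \<in> forms_avoiding i0 (e x)) \<Longrightarrow> prod f A \<in> forms_avoiding i0 (sum e A)"
  by (induction A rule: infinite_finite_induct) (simp_all add: forms_avoiding_closed)

lemma forms_avoiding_single:
  "m \<in> monomials_avoiding i0 d \<Longrightarrow> Poly_Mapping.single m c \<in> forms_avoiding i0 d"
  by (simp add: forms_avoiding_def)

lemma fps_const_sum: "(\<Sum>x\<in>A. fps_const (f x)) = fps_const (sum f A)"
  by (induction A rule: infinite_finite_induct) simp_all

lemma fps_const_prod: "(\<Prod>x\<in>A. fps_const (f x)) = fps_const (\<Prod>x\<in>A. f x)"
  by (induction A rule: infinite_finite_induct) simp_all

text \<open>
  A form of degree 6 that is a multiple of \<open>L\<close> plus a combination of the cubes is, after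
  elimination of \<open>x\<^sub>i\<^sub>0\<close> by means of \<open>L = 0\<close>, a combination of the products of the cubes with the
  monomials of degree 3. For eight cubes in seven variables there are \<open>8 \<cdot> 56 = 448\<close> such
  products, but there are 462 monomials of degree 6. The coefficients \<open>f\<close> and \<open>q\<close> need not be
  homogeneous; scaling the variables by the power series variable extracts the homogeneous
  parts.
\<close>
lemma not_all_forms_generated:
  fixes b :: "'j \<Rightarrow> 'n::finite \<Rightarrow> complex" and c :: "'n \<Rightarrow> complex"
  assumes "finite J" and c: "c i0 \<noteq> 0"
    and less: "card J * card (monomials_avoiding i0 3) < card (monomials_avoiding i0 6)"
  shows "\<exists>h\<in>homogeneous 6. \<forall>f q. h \<noteq> lin_form c * f + (\<Sum>j\<in>J. lin_form (b j) ^ 3 * q j)"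
proof (rule ccontr)
  assume "\<not> ?thesis"
  then have gen: "\<forall>h\<in>homogeneous 6. \<exists>f q. h = lin_form c * f + (\<Sum>j\<in>J. lin_form (b j) ^ 3 * q j)"
    by simp
  define \<kappa> :: "complex \<Rightarrow> 'n mpoly fps" where "\<kappa> = (\<lambda>x. fps_const (Poly_Mapping.single 0 x))"
  interpret coefficient_hom \<kappa>
    by unfold_locales (simp_all add: \<kappa>_def single_add mult_single)
  define x :: "'n \<Rightarrow> 'n mpoly" where "x i = Poly_Mapping.single (Poly_Mapping.single i 1) 1" for i
  \<comment> \<open>solves \<open>L = 0\<close> for the variable \<open>i0\<close>\<close>
  define \<psi> where "\<psi> i = (if i = i0 then - (\<Sum>k\<in>UNIV - {i0}. Poly_Mapping.single 0 (c k / c i0) * x k) else x i)" for i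
  define \<theta> where "\<theta> = mpoly_subst \<kappa> (\<lambda>i. fps_X * fps_const (\<psi> i))"
  have \<theta>_lin: "\<theta> (lin_form a) = fps_X * fps_const (\<Sum>i\<in>UNIV. Poly_Mapping.single 0 (a i) * \<psi> i)" for a
  proof -
    have "\<theta> (lin_form a) = (\<Sum>i\<in>UNIV. fps_X * fps_const (Poly_Mapping.single 0 (a i) * \<psi> i))"
      unfolding \<theta>_def subst_lin_form by (simp add: \<kappa>_def mult.left_commute[of _ fps_X])
    also have "\<dots> = fps_X * fps_const (\<Sum>i\<in>UNIV. Poly_Mapping.single 0 (a i) * \<psi> i)"
      by (simp add: fps_const_sum flip: sum_distrib_left)
    finally show ?thesis .
  qed
  have "(\<Sum>i\<in>UNIV. Poly_Mapping.single 0 (c i) * \<psi> i)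
      = Poly_Mapping.single 0 (c i0) * \<psi> i0 + (\<Sum>i\<in>UNIV - {i0}. Poly_Mapping.single 0 (c i) * \<psi> i)"
    by (simp add: sum.remove)
  also have "Poly_Mapping.single 0 (c i0) * \<psi> i0 = - (\<Sum>i\<in>UNIV - {i0}. Poly_Mapping.single 0 (c i) * x i)"
    using c by (simp add: \<psi>_def sum_distrib_left mult_single flip: mult.assoc)
  finally have \<theta>L: "\<theta> (lin_form c) = 0"
    by (simp add: \<theta>_lin) (simp add: \<psi>_def)
  have x1: "x i \<in> forms_avoiding i0 1" if "i \<noteq> i0" for i
    unfolding x_def using that
    by (intro forms_avoiding_single) (simp add: monomials_avoiding_def lookup_single when_def)
  have neg: "- p \<in> forms_avoiding i0 d" if "p \<in> forms_avoiding i0 d" for p d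
    using that by (auto simp: forms_avoiding_def in_keys_iff subset_iff)
  have const: "Poly_Mapping.single 0 z \<in> forms_avoiding i0 0" for z
    by (intro forms_avoiding_single) (simp add: monomials_avoiding_def)
  have \<psi>1: "\<psi> i \<in> forms_avoiding i0 1" for i
    using forms_avoiding_closed(4)[OF const x1] x1
    by (auto simp: \<psi>_def intro!: neg forms_avoiding_sum)
  have \<theta>3: "fps_nth (\<theta> q) n \<in> forms_avoiding i0 n" for q n
  proof -
    have "fps_nth (\<theta> q) n = (\<Sum>m\<in>Poly_Mapping.keys q.
        fps_nth (\<kappa> (Poly_Mapping.lookup q m) * (\<Prod>i\<in>UNIV. (fps_X * fps_const (\<psi> i)) ^ Poly_Mapping.lookup m i)) n)"
      by (simp add: \<theta>_def mpoly_subst_def fps_sum_nth)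
    also have "\<dots> \<in> forms_avoiding i0 n"
    proof (rule forms_avoiding_sum)
      fix m :: "'n \<Rightarrow>\<^sub>0 nat"
      let ?d = "\<Sum>i\<in>UNIV. Poly_Mapping.lookup m i"
      let ?p = "Poly_Mapping.single 0 (Poly_Mapping.lookup q m) * (\<Prod>i\<in>UNIV. \<psi> i ^ Poly_Mapping.lookup m i)"
      have "(\<Prod>i\<in>UNIV. fps_const (\<psi> i) ^ Poly_Mapping.lookup m i) = fps_const (\<Prod>i\<in>UNIV. \<psi> i ^ Poly_Mapping.lookup m i)"
        by (simp add: fps_const_prod fps_const_power)
      then have "\<kappa> (Poly_Mapping.lookup q m) * (\<Prod>i\<in>UNIV. (fps_X * fps_const (\<psi> i)) ^ Poly_Mapping.lookup m i)
          = fps_X ^ ?d * fps_const ?p"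
        by (simp add: power_mult_distrib prod.distrib power_sum \<kappa>_def mult_ac flip: fps_const_mult)
      moreover have "?p \<in> forms_avoiding i0 ?d"
        using forms_avoiding_closed(4)[OF const forms_avoiding_prod[OF forms_avoiding_power[OF \<psi>1]]] by simp
      ultimately show "fps_nth (\<kappa> (Poly_Mapping.lookup q m) * (\<Prod>i\<in>UNIV. (fps_X * fps_const (\<psi> i)) ^ Poly_Mapping.lookup m i)) n
          \<in> forms_avoiding i0 n"
        by (auto simp: fps_X_power_mult_nth forms_avoiding_closed(1))
    qed
    finally show ?thesis .
  qed
  let ?l = "\<lambda>j. \<Sum>i\<in>UNIV. Poly_Mapping.single 0 (b j i) * \<psi> i"
  let ?T = "(\<lambda>(j, m). ?l j ^ 3 * Poly_Mapping.single m 1) ` (J \<times> monomials_avoiding i0 3)"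
  let ?S = "(\<lambda>m. Poly_Mapping.single m 1 :: 'n mpoly) ` monomials_avoiding i0 6"
  have "?S \<subseteq> mpoly_vs.span ?T"
  proof
    fix h assume "h \<in> ?S"
    then obtain m where m: "m \<in> monomials_avoiding i0 6" "h = Poly_Mapping.single m 1" by blast
    then have "h \<in> homogeneous 6" by (simp add: monomials_avoiding_def homogeneous_single)
    then obtain f q where h: "h = lin_form c * f + (\<Sum>j\<in>J. lin_form (b j) ^ 3 * q j)" using gen by blast
    have "\<theta> h = (\<Sum>j\<in>J. fps_X ^ 3 * (fps_const (?l j ^ 3) * \<theta> (q j)))"
      using \<theta>L \<theta>_lin unfolding h
      by (simp add: \<theta>_def subst_add subst_mult subst_sum subst_power power_mult_distrib fps_const_power mult_ac)
    then have "fps_nth (\<theta> h) 6 = (\<Sum>j\<in>J. ?l j ^ 3 * fps_nth (\<theta> (q j)) 3)"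
      by (simp add: fps_sum_nth fps_X_power_mult_nth)
    moreover have "fps_nth (\<theta> h) 6 = h"
    proof -
      have "(\<Prod>i\<in>UNIV. (fps_X * fps_const (\<psi> i)) ^ Poly_Mapping.lookup m i)
          = (\<Prod>i\<in>UNIV. (fps_X * fps_const (x i)) ^ Poly_Mapping.lookup m i)"
        using m by (intro prod.cong) (auto simp: \<psi>_def monomials_avoiding_def)
      also have "\<dots> = fps_X ^ 6 * fps_const (\<Prod>i\<in>UNIV. x i ^ Poly_Mapping.lookup m i)"
        using m by (simp add: power_mult_distrib prod.distrib monomials_avoiding_def fps_const_power fps_const_prod
            flip: power_sum)
      also have "(\<Prod>i\<in>UNIV. x i ^ Poly_Mapping.lookup m i) = h"
      proof -
        have pow: "x i ^ k = Poly_Mapping.single (Poly_Mapping.single i k) 1" for i k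
          by (induction k) (simp_all add: x_def mult_single flip: single_add)
        have "(\<Prod>i\<in>A. x i ^ Poly_Mapping.lookup m i)
            = Poly_Mapping.single (\<Sum>i\<in>A. Poly_Mapping.single i (Poly_Mapping.lookup m i)) 1" for A
          by (induction A rule: infinite_finite_induct) (simp_all add: pow mult_single)
        moreover have "(\<Sum>i\<in>UNIV. Poly_Mapping.single i (Poly_Mapping.lookup m i)) = m"
          by (rule poly_mapping_eqI) (simp add: lookup_sum lookup_single when_def)
        ultimately show ?thesis by (simp add: m)
      qed
      finally show ?thesis
        by (simp add: m(2) \<theta>_def subst_single coeff_one fps_X_power_mult_nth)
    qed
    ultimately have heq: "h = (\<Sum>j\<in>J. ?l j ^ 3 * fps_nth (\<theta> (q j)) 3)" by simp
    show "h \<in> mpoly_vs.span ?T"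
      unfolding heq
    proof (rule mpoly_vs.span_sum)
      fix j assume j: "j \<in> J"
      let ?p = "fps_nth (\<theta> (q j)) 3"
      have "?l j ^ 3 * ?p = ?l j ^ 3 * (\<Sum>m\<in>Poly_Mapping.keys ?p. Poly_Mapping.single m (Poly_Mapping.lookup ?p m))"
        by (simp flip: mpoly_monomials)
      also have "\<dots> = (\<Sum>m\<in>Poly_Mapping.keys ?p.
          scale_mpoly (Poly_Mapping.lookup ?p m) (?l j ^ 3 * Poly_Mapping.single m 1))"
        unfolding sum_distrib_left scale_mpoly_def
        by (simp add: mult.left_commute[of "Poly_Mapping.single 0 _"] mult_single)
      also have "\<dots> \<in> mpoly_vs.span ?T"
        using \<theta>3[of "q j" 3] j unfolding forms_avoiding_def
        by (intro mpoly_vs.span_sum mpoly_vs.span_scale mpoly_vs.span_base) auto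
      finally show "?l j ^ 3 * ?p \<in> mpoly_vs.span ?T" .
    qed
  qed
  moreover have finT: "finite ?T" using assms(1) finite_card_monomials_avoiding(1) by blast
  ultimately have "card ?S \<le> card ?T"
    using mpoly_vs.independent_span_bound[OF finT independent_monomials] by blast
  moreover have "card ?S = card (monomials_avoiding i0 6)"
    by (rule card_image) (auto simp: inj_on_def)
  moreover have "card ?T \<le> card J * card (monomials_avoiding i0 3)"
    unfolding card_cartesian_product[symmetric]
    by (rule card_image_le) (simp add: assms(1) finite_card_monomials_avoiding(1))
  ultimately show False using less by linarith
qed

section \<open>Ideals and quotients of the polynomial ring\<close>

lemma type_algebra_simps:
  "carrier (ring_of_type_algebra :: 'r::comm_ring_1 ring) = UNIV"
  "x \<otimes>\<^bsub>(ring_of_type_algebra :: 'r ring)\<^esub> y = x * y"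
  "x \<oplus>\<^bsub>(ring_of_type_algebra :: 'r ring)\<^esub> y = x + y"
  "\<zero>\<^bsub>(ring_of_type_algebra :: 'r ring)\<^esub> = 0"
  by (simp_all add: ring_of_type_algebra_def)

interpretation type_algebra: cring "ring_of_type_algebra :: 'r::comm_ring_1 ring"
  by (rule cring_from_type_algebra)

lemma type_algebra_uminus: "\<ominus>\<^bsub>(ring_of_type_algebra :: 'r::comm_ring_1 ring)\<^esub> x = - x"
  by (rule type_algebra.minus_equality) (simp_all add: type_algebra_simps)

lemma ideal_iff_closed_ideal:
  "ideal I (ring_of_type_algebra :: 'r::comm_ring_1 ring) \<longleftrightarrow> closed_ideal I"
proof
  assume I: "ideal I (ring_of_type_algebra :: 'r ring)"
  note add = ideal.axioms(1)[OF I]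
  show "closed_ideal I"
    unfolding closed_ideal_def
    using additive_subgroup.zero_closed[OF add] additive_subgroup.a_closed[OF add] ideal.I_l_closed[OF I]
    by (simp add: type_algebra_simps)
next
  assume I: "closed_ideal I"
  have "subgroup I (add_monoid (ring_of_type_algebra :: 'r ring))"
  proof (rule group.subgroupI[OF type_algebra.a_group])
    show "inv\<^bsub>add_monoid (ring_of_type_algebra :: 'r ring)\<^esub> x \<in> I" if "x \<in> I" for x
      using closed_idealD(3)[OF I that, of "- 1"] type_algebra_uminus[of x] by (simp add: a_inv_def)
  qed (use closed_idealD[OF I] in \<open>auto simp: type_algebra_simps\<close>)
  then show "ideal I (ring_of_type_algebra :: 'r ring)"
    using closed_idealD[OF I] closed_ideal_mult_right[OF I]
    by (intro idealI type_algebra.ring_axioms) (simp_all add: type_algebra_simps)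
qed

lemma closed_ideal_genideal: "closed_ideal (Idl\<^bsub>ring_of_type_algebra\<^esub> S)"
  unfolding ideal_iff_closed_ideal[symmetric]
  by (rule type_algebra.genideal_ideal) (simp add: type_algebra_simps)

lemma genideal_superset: "(S :: 'r::comm_ring_1 set) \<subseteq> Idl\<^bsub>ring_of_type_algebra\<^esub> S"
  by (rule type_algebra.genideal_self) (simp add: type_algebra_simps)

lemma genideal_least: "closed_ideal I \<Longrightarrow> S \<subseteq> I \<Longrightarrow> Idl\<^bsub>ring_of_type_algebra\<^esub> S \<subseteq> I"
  by (rule type_algebra.genideal_minimal) (simp_all add: ideal_iff_closed_ideal)

lemma genideal_image_combination:
  fixes x :: "'j \<Rightarrow> 'r::comm_ring_1"
  assumes "finite J" "p \<in> Idl\<^bsub>ring_of_type_algebra\<^esub> (x ` J)"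
  obtains q where "p = (\<Sum>j\<in>J. x j * q j)"
proof -
  let ?I = "{p. \<exists>q. p = (\<Sum>j\<in>J. x j * q j)}"
  have "closed_ideal ?I"
    unfolding closed_ideal_def mem_Collect_eq Ball_def
  proof (intro conjI allI impI; (elim exE)?)
    show "\<exists>q. 0 = (\<Sum>j\<in>J. x j * q j)" by (rule exI[of _ "\<lambda>_. 0"]) simp
    fix a b q r assume "a = (\<Sum>j\<in>J. x j * q j)" "b = (\<Sum>j\<in>J. x j * r j)"
    then show "\<exists>q. a + b = (\<Sum>j\<in>J. x j * q j)"
      by (intro exI[of _ "\<lambda>j. q j + r j"]) (simp add: distrib_left sum.distrib)
  next
    fix a q s assume "a = (\<Sum>j\<in>J. x j * q j)"
    then show "\<exists>q. s * a = (\<Sum>j\<in>J. x j * q j)"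
      by (intro exI[of _ "\<lambda>j. s * q j"]) (simp add: sum_distrib_left mult_ac)
  qed
  moreover have "x j \<in> ?I" if "j \<in> J" for j
    using that assms(1)
    by (auto intro!: exI[of _ "\<lambda>k. if k = j then 1 else 0"] simp: if_distrib[of "\<lambda>z. _ * z"] cong: if_cong)
  ultimately have "Idl\<^bsub>ring_of_type_algebra\<^esub> (x ` J) \<subseteq> ?I"
    by (intro genideal_least) auto
  then show ?thesis using assms(2) that by blast
qed

lemma coset_eq_iff:
  assumes "closed_ideal I"
  shows "I +>\<^bsub>ring_of_type_algebra\<^esub> f = I +>\<^bsub>ring_of_type_algebra\<^esub> g \<longleftrightarrow> f - g \<in> I"
  using type_algebra.quotient_eq_iff_same_a_r_cos[OF assms[folded ideal_iff_closed_ideal], of f g]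
  by (simp add: type_algebra_simps a_minus_def type_algebra_uminus)

lemma mult_map_coset:
  assumes "closed_ideal I"
  shows "mult_map I L (I +>\<^bsub>mpoly_ring\<^esub> f) = I +>\<^bsub>mpoly_ring\<^esub> (L * f)"
  using ideal.rcoset_mult_add[OF assms[folded ideal_iff_closed_ideal], of L f]
  by (simp add: mult_map_def FactRing_def type_algebra_simps)

lemma not_maximal_rankI:
  assumes I: "closed_ideal I"
    and f: "f \<in> homogeneous d" "f \<notin> I" "L * f \<in> I"
    and h: "h \<in> homogeneous (Suc d)" "\<And>g. g \<in> homogeneous d \<Longrightarrow> h - L * g \<notin> I"
  shows "\<not> maximal_rank I L d"
proof -
  let ?c = "\<lambda>g. I +>\<^bsub>mpoly_ring\<^esub> g"
  have "\<not> inj_on (mult_map I L) (quotient_part I d)"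
  proof
    assume inj: "inj_on (mult_map I L) (quotient_part I d)"
    have "mult_map I L (?c f) = mult_map I L (?c 0)"
      using f(3) by (simp add: mult_map_coset[OF I] coset_eq_iff[OF I])
    then have "?c f = ?c 0"
      using inj f(1) homogeneous_zero by (auto simp: quotient_part_def inj_on_def)
    then show False using f(2) by (simp add: coset_eq_iff[OF I])
  qed
  moreover have "?c h \<notin> mult_map I L ` quotient_part I d"
    using h(2) by (auto simp: quotient_part_def mult_map_coset[OF I] coset_eq_iff[OF I])
  moreover have "?c h \<in> quotient_part I (Suc d)" using h(1) by (simp add: quotient_part_def)
  ultimately show ?thesis unfolding maximal_rank_def by blast
qed

section \<open>Failure of maximal rank in general position\<close>

lemma lin_form_scale: "lin_form (\<lambda>i. s * c i) = Poly_Mapping.single 0 s * lin_form c"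
  by (simp add: lin_form_def sum_distrib_left mult_single)

lemma lin_form_sum: "lin_form (\<lambda>i. \<Sum>j\<in>A. c j i) = (\<Sum>j\<in>A. lin_form (c j))"
proof (induction A rule: infinite_finite_induct)
  case (insert j A)
  have "lin_form (\<lambda>i. c j i + d i) = lin_form (c j) + lin_form d" for d
    by (simp add: lin_form_def single_add sum.distrib)
  with insert show ?case by simp
qed (simp_all add: lin_form_def)

text \<open>
  The hypotheses describe general position: the first seven forms are linearly independent, the
  relation among all eight has nonzero coefficients, and \<open>L\<close> is a combination of the rescaled forms
  \<open>M\<^sub>j = \<beta>\<^sub>j L\<^sub>j\<close> with distinct coefficients. Rescaling turns the relation into \<open>\<Sum>\<^sub>j M\<^sub>j = 0\<close> and does not
  change the ideal of the cubes.
\<close>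

lemma not_maximal_rank_special_position:
  fixes c :: "nat \<Rightarrow> 'n::finite \<Rightarrow> complex" and \<alpha> \<beta> :: "nat \<Rightarrow> complex" and d :: "'n \<Rightarrow> complex"
  assumes n: "CARD('n) = 7"
    and \<beta>: "\<And>j. j < 8 \<Longrightarrow> \<beta> j \<noteq> 0" and inj: "inj_on \<alpha> {..<8}"
    and relation: "\<And>i. (\<Sum>j<8. \<beta> j * c j i) = 0"
    and d: "\<And>i. d i = (\<Sum>j<8. \<alpha> j * (\<beta> j * c j i))"
    and solvable: "\<And>y. \<exists>v. \<forall>j<7. (\<Sum>i\<in>UNIV. c j i * v i) = y j"
  shows "\<not> maximal_rank (Idl\<^bsub>mpoly_ring\<^esub> ((\<lambda>j. lin_form (c j) ^ 3) ` {..<8})) (lin_form d) 5"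
proof -
  define b where "b j i = \<beta> j * c j i" for j i
  define M where "M = (\<lambda>j. lin_form (b j))"
  define a :: "nat \<Rightarrow> 'n mpoly" where "a = (\<lambda>j. Poly_Mapping.single 0 (\<alpha> j))"
  let ?I = "Idl\<^bsub>mpoly_ring\<^esub> ((\<lambda>j. lin_form (c j) ^ 3) ` {..<8})"
  note I = closed_ideal_genideal[of "(\<lambda>j. lin_form (c j) ^ 3) ` {..<8}"]
  have M: "M j = Poly_Mapping.single 0 (\<beta> j) * lin_form (c j)" for j
    by (simp add: M_def b_def[abs_def] lin_form_scale)
  have L: "lin_form d = (\<Sum>j<8. M j * a j)"
  proof -
    have "d = (\<lambda>i. \<Sum>j<8. \<alpha> j * b j i)" by (simp add: fun_eq_iff d b_def)
    then show ?thesis by (simp add: lin_form_sum lin_form_scale M_def a_def mult.commute)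
  qed
  have M0: "(\<Sum>j<8. M j) = 0"
  proof -
    have "(\<Sum>j<8. M j) = lin_form (\<lambda>i. \<Sum>j<8. b j i)" by (simp add: M_def lin_form_sum)
    then show ?thesis by (simp add: b_def relation) (simp add: lin_form_def)
  qed
  have cubes: "M j ^ 3 \<in> ?I" if "j < 8" for j
  proof -
    have "lin_form (c j) ^ 3 \<in> ?I"
      using genideal_superset[of "(\<lambda>j. lin_form (c j) ^ 3) ` {..<8}"] that by auto
    then show ?thesis unfolding M power_mult_distrib by (rule closed_idealD(3)[OF I])
  qed
  have dual: "\<exists>v. \<forall>j<8. mpoly_eval (M j) v = y j" if y: "(\<Sum>j<8. y j) = 0" for y
  proof -
    obtain v where v: "\<And>j. j < 7 \<Longrightarrow> (\<Sum>i\<in>UNIV. c j i * v i) = y j / \<beta> j"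
      using solvable[of "\<lambda>j. y j / \<beta> j"] by blast
    have ev: "mpoly_eval (M j) v = \<beta> j * (\<Sum>i\<in>UNIV. c j i * v i)" for j
      by (simp add: M_def b_def mpoly_eval_eq_subst coefficient_hom.subst_lin_form[OF coefficient_hom_id]
          sum_distrib_left mult.assoc)
    have 7: "mpoly_eval (M j) v = y j" if "j < 7" for j
      using v[OF that] \<beta>[of j] that by (simp add: ev)
    have "(\<Sum>j<8. mpoly_eval (M j) v) = (\<Sum>i\<in>UNIV. (\<Sum>j<8. \<beta> j * c j i) * v i)"
      unfolding ev sum_distrib_left sum_distrib_right by (subst sum.swap) (simp add: mult.assoc)
    then have "(\<Sum>j<8. mpoly_eval (M j) v) = (\<Sum>j<8. y j)" by (simp add: relation y)
    moreover have "{..<8::nat} = insert 7 {..<7}" by auto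
    ultimately have "mpoly_eval (M 7) v = y 7" using 7 by simp
    with 7 have "mpoly_eval (M j) v = y j" if "j < 8" for j
      using that by (cases "j = 7") auto
    then show ?thesis by blast
  qed
  \<comment> \<open>\<open>d = 0\<close> would force \<open>\<alpha> 0 = \<alpha> 1\<close>: evaluate at a point where only \<open>M 0\<close> and \<open>M 1\<close> do not vanish\<close>
  obtain i0 where i0: "d i0 \<noteq> 0"
  proof (rule ccontr)
    assume "\<not> thesis"
    then have "d = (\<lambda>i. 0)" using that by auto
    then have "lin_form d = 0" by (simp add: lin_form_def)
    define y :: "nat \<Rightarrow> complex" where "y j = (if j = 0 then 1 else if j = 1 then - 1 else 0)" for j
    have s01: "(\<Sum>j<8. y j * g j) = g 0 - g 1" for g
    proof -
      have "(\<Sum>j<8. y j * g j) = (\<Sum>j\<in>{0, 1}. y j * g j)"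
        by (rule sum.mono_neutral_right) (auto simp: y_def)
      then show ?thesis by (simp add: y_def)
    qed
    obtain v where v: "\<forall>j<8. mpoly_eval (M j) v = y j"
      using dual[of y] s01[of "\<lambda>_. 1"] by auto
    have "0 = mpoly_eval (lin_form d) v"
      using \<open>lin_form d = 0\<close> by (simp add: mpoly_eval_def)
    also have "\<dots> = (\<Sum>j<8. mpoly_eval (M j) v * \<alpha> j)"
      unfolding L a_def mpoly_eval_eq_subst
      by (simp add: coefficient_hom.subst_sum[OF coefficient_hom_id] coefficient_hom.subst_mult[OF coefficient_hom_id]
          coefficient_hom.subst_single[OF coefficient_hom_id])
    also have "\<dots> = \<alpha> 0 - \<alpha> 1" using v s01[of \<alpha>] by simp
    finally show False using inj_onD[OF inj, of 0 1] by simp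
  qed
  have hom: "cofactor {..<8} M a \<in> homogeneous 5"
    by (rule cofactor_homogeneous) (simp_all add: M_def a_def homogeneous_lin_form[simplified] homogeneous_const)
  have mem: "lin_form d * cofactor {..<8} M a \<in> ?I"
    unfolding L by (rule linear_times_cofactor_mem[OF M0 _ _ I]) (use cubes in auto)
  have notmem: "cofactor {..<8} M a \<notin> ?I"
  proof
    assume f: "cofactor {..<8} M a \<in> ?I"
    obtain N where N: "closed_ideal N" "\<forall>j<8. M j ^ 3 \<in> N" "(\<Sum>j<8. M j * a j) \<in> N"
      "6 * (\<Sum>j<8. M j * a j ^ 2) ^ 5 \<notin> N"
      using separating_ideal[OF inj, of b] dual unfolding M_def a_def by blast
    have "lin_form (c j) ^ 3 \<in> N" if "j < 8" for j
    proof -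
      have "lin_form (c j) = Poly_Mapping.single 0 (inverse (\<beta> j)) * M j"
        using \<beta>[OF that] by (simp add: M mult_single flip: mult.assoc)
      then show ?thesis using N(1,2) that by (simp add: power_mult_distrib closed_idealD(3))
    qed
    then have "?I \<subseteq> N" by (intro genideal_least N) auto
    with f have "cofactor {..<8} M a \<in> N" by blast
    moreover obtain g where g: "cofactor {..<8} M a = 6 * (\<Sum>j<8. M j * a j ^ 2) ^ 5 + (\<Sum>j<8. M j * a j) * g"
      using cofactor_mod_linear[OF M0] by blast
    moreover have "(\<Sum>j<8. M j * a j) * g \<in> N" by (rule closed_ideal_mult_right[OF N(1,3)])
    ultimately have "cofactor {..<8} M a - (\<Sum>j<8. M j * a j) * g \<in> N"
      by (intro closed_ideal_diff[OF N(1)])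
    then have "6 * (\<Sum>j<8. M j * a j ^ 2) ^ 5 \<in> N"
      unfolding g add_diff_cancel_right' .
    with N(4) show False by blast
  qed
  \<comment> \<open>\<open>448 < 462\<close>\<close>
  have "8 * card (monomials_avoiding i0 3) < card (monomials_avoiding i0 6)"
    by (simp add: finite_card_monomials_avoiding(2) n binomial_fact' fact_numeral)
  then obtain h where h: "h \<in> homogeneous 6" "\<And>f q. h \<noteq> lin_form d * f + (\<Sum>j<8. lin_form (c j) ^ 3 * q j)"
    using not_all_forms_generated[of "{..<8::nat}" d i0 c] i0 by auto
  show ?thesis
  proof (rule not_maximal_rankI[OF I hom notmem mem])
    show "h \<in> homogeneous (Suc 5)" using h(1) by simp
    fix g
    show "h - lin_form d * g \<notin> ?I"
    proof
      assume "h - lin_form d * g \<in> ?I"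
      then obtain q where "h - lin_form d * g = (\<Sum>j<8. lin_form (c j) ^ 3 * q j)"
        using genideal_image_combination[of "{..<8}" "h - lin_form d * g" "\<lambda>j. lin_form (c j) ^ 3"] by blast
      then have "h = lin_form d * g + (\<Sum>j<8. lin_form (c j) ^ 3 * q j)" by (simp add: algebra_simps)
      with h(2) show False by blast
    qed
  qed
qed

section \<open>General position is a Zariski open condition\<close>

definition matrix_det :: "('n::finite \<Rightarrow> 'n \<Rightarrow> complex) \<Rightarrow> complex" where
  "matrix_det C = det (\<chi> i k. C i k)"

definition cramer_det :: "('n::finite \<Rightarrow> 'n \<Rightarrow> complex) \<Rightarrow> ('n \<Rightarrow> complex) \<Rightarrow> 'n \<Rightarrow> complex" where
  "cramer_det C r k = matrix_det (\<lambda>i l. if l = k then r i else C i l)"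

text \<open>
  Cramer's rule shows that the coefficients of the relation among the forms, and those of \<open>L\<close> in terms
  of the forms, are quotients of polynomial functions; their nonvanishing and distinctness are
  then open conditions.
\<close>

lemma cramer_solution:
  assumes "matrix_det C \<noteq> 0"
  shows "(\<forall>i. (\<Sum>k\<in>UNIV. C i k * z k) = r i) \<longleftrightarrow> (\<forall>k. z k = cramer_det C r k / matrix_det C)"
proof -
  have "((\<chi> i k. C i k) *v (\<chi> k. z k) = (\<chi> i. r i)) \<longleftrightarrow> (\<forall>k. z k = cramer_det C r k / matrix_det C)"
    using cramer[of "\<chi> i k. C i k" "\<chi> k. z k" "\<chi> i. r i"] assms
    by (simp add: matrix_det_def cramer_det_def vec_eq_iff if_distrib cong: if_cong)
  then show ?thesis by (simp add: matrix_vector_mult_def vec_eq_iff)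
qed

lemma matrix_det_transpose: "matrix_det (\<lambda>i k. C k i) = matrix_det C"
  using det_transpose[of "\<chi> i k. C i k"] by (simp add: matrix_det_def transpose_def)

lemma polynomial_function_matrix_det:
  assumes "\<And>i k. polynomial_function (\<lambda>v. C v i k)"
  shows "polynomial_function (\<lambda>v. matrix_det (C v))"
  unfolding matrix_det_def det_def
  by (simp, intro polynomial_function_sum polynomial_function_mult polynomial_function_prod
      polynomial_function_const assms)

lemma polynomial_function_cramer_det:
  assumes "\<And>i k. polynomial_function (\<lambda>v. C v i k)" "\<And>i. polynomial_function (\<lambda>v. r v i)"
  shows "polynomial_function (\<lambda>v. cramer_det (C v) (r v) k)"
  unfolding cramer_det_def
proof (rule polynomial_function_matrix_det)
  show "polynomial_function (\<lambda>v. if l = k then r v i else C v i l)" for i l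
    using assms by (cases "l = k") simp_all
qed

text \<open>
  The coefficients \<open>\<alpha>\<close> of \<open>L\<close> are only determined up to a common translation, because the rescaled
  forms add up to zero. They are normalised by giving the form \<open>j0\<close> the coefficient 0; the
  others are then linear functions of \<open>L\<close>, and their distinctness is the nonvanishing of the
  polynomial \<open>D\<close>.
\<close>

lemma fails_WLP_generic:
  fixes \<iota> :: "'k::finite \<Rightarrow> 'j::finite" and j0 :: 'j and c :: "'j \<times> 'k \<Rightarrow> complex"
  assumes n: "CARD('k) = 7" and \<iota>: "bij_betw \<iota> UNIV (UNIV - {j0})"
    and det: "matrix_det (\<lambda>i k. c (\<iota> k, i)) \<noteq> 0"
    and cram: "\<And>k. cramer_det (\<lambda>i k. c (\<iota> k, i)) (\<lambda>i. c (j0, i)) k \<noteq> 0"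
  shows "fails_WLP_in_degree (Idl\<^bsub>mpoly_ring\<^esub> (range (\<lambda>j. lin_form (\<lambda>i. c (j, i)) ^ 3))) 5"
proof -
  obtain g :: "nat \<Rightarrow> 'k" where g: "bij_betw g {..<7} UNIV"
    using n by (metis card_lessThan finite finite_lessThan finite_same_card_bij)
  define e where "e m = (if m = 7 then j0 else \<iota> (g m))" for m
  have "bij_betw (\<iota> \<circ> g) {..<7} (UNIV - {j0})"
    using g \<iota> by (rule bij_betw_trans)
  then have "bij_betw e {..<7} (UNIV - {j0})"
    by (rule bij_betw_cong[THEN iffD1, rotated]) (simp add: e_def)
  then have "bij_betw e (insert 7 {..<7}) (insert j0 (UNIV - {j0}))"
    by (rule bij_betw_combine[of e "{7}" "{j0}" "{..<7}", simplified, rotated])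
       (auto simp: bij_betw_def e_def)
  moreover have split8: "{..<8::nat} = insert 7 {..<7}" by auto
  ultimately have e: "bij_betw e {..<8} UNIV" by (simp add: insert_absorb)
  define C where "C = (\<lambda>i k. c (\<iota> k, i))"
  define \<beta> where "\<beta> k = cramer_det C (\<lambda>i. c (j0, i)) k / matrix_det C" for k
  have \<beta>0: "\<beta> k \<noteq> 0" for k using det cram by (simp add: \<beta>_def C_def)
  have \<beta>eq: "(\<Sum>k\<in>UNIV. C i k * \<beta> k) = c (j0, i)" for i
    using cramer_solution[of C \<beta> "\<lambda>i. c (j0, i)"] det by (simp add: \<beta>_def C_def)
  \<comment> \<open>indices of the forms become \<open>0, \<dots>, 7\<close>, with 7 for the form \<open>j0\<close>\<close>
  define \<beta>' where "\<beta>' m = (if m = 7 then - 1 else \<beta> (g m))" for m :: nat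
  define A where "A d m = (if m = 7 then 0 else cramer_det C d (g m) / (matrix_det C * \<beta> (g m)))"
    for d and m :: nat
  define D where "D d = (\<Prod>m<8. \<Prod>l\<in>{..<8} - {m}. A d m - A d l)" for d
  have reindex: "(\<Sum>m<8. F m) = F 7 + (\<Sum>k\<in>UNIV. F (inv_into {..<7} g k))" for F :: "nat \<Rightarrow> complex"
  proof -
    have "bij_betw (inv_into {..<7} g) UNIV {..<7}" using g by (rule bij_betw_inv_into)
    from sum.reindex_bij_betw[OF this, of F] show ?thesis by (simp add: split8)
  qed
  have inv: "g (inv_into {..<7} g k) = k" "inv_into {..<7} g k \<noteq> 7" for k
    using bij_betw_inv_into_right[OF g] bij_betwE[OF bij_betw_inv_into[OF g]]
    by (auto dest!: spec[of _ k])
  have "polynomial_function (\<lambda>d. A d m)" for m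
  proof (cases "m = 7")
    case False
    have "polynomial_function (\<lambda>d. cramer_det C d (g m) * inverse (matrix_det C * \<beta> (g m)))"
      by (intro polynomial_function_mult polynomial_function_const polynomial_function_cramer_det
          polynomial_function_coord)
    with False show ?thesis by (simp add: A_def divide_inverse)
  qed (simp add: A_def polynomial_function_const)
  then have D: "polynomial_function D"
    unfolding D_def by (intro polynomial_function_prod polynomial_function_diff)
  \<comment> \<open>a form with the distinct coefficients \<open>1, \<dots>, 7\<close> and 0\<close>
  define d0 where "d0 i = (\<Sum>k\<in>UNIV. C i k * (of_nat (Suc (inv_into {..<7} g k)) * \<beta> k))" for i
  have A0: "A d0 m = (if m = 7 then 0 else of_nat (Suc m))" if "m < 8" for m
  proof (cases "m = 7")
    case False
    have "inv_into {..<7} g (g m) = m"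
      using g False that by (intro inv_into_f_f) (auto simp: bij_betw_def)
    moreover have "of_nat (Suc (inv_into {..<7} g (g m))) * \<beta> (g m) = cramer_det C d0 (g m) / matrix_det C"
      using cramer_solution[of C "\<lambda>k. of_nat (Suc (inv_into {..<7} g k)) * \<beta> k" d0] det
      by (simp add: d0_def C_def)
    ultimately show ?thesis using False \<beta>0[of "g m"] det by (simp add: A_def field_simps C_def)
  qed (simp add: A_def)
  have D0: "D d0 \<noteq> 0"
    by (auto simp: D_def A0 simp del: of_nat_Suc split: if_splits)
  have "\<not> maximal_rank (Idl\<^bsub>mpoly_ring\<^esub> ((\<lambda>m. lin_form (\<lambda>i. c (e m, i)) ^ 3) ` {..<8})) (lin_form d) 5"
    if "D d \<noteq> 0" for d
  proof (rule not_maximal_rank_special_position[OF n])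
    show "\<beta>' m \<noteq> 0" for m using \<beta>0 by (simp add: \<beta>'_def)
    show "inj_on (A d) {..<8}"
      using that by (auto simp: D_def inj_on_def)
    show "(\<Sum>m<8. \<beta>' m * c (e m, i)) = 0" for i
      using \<beta>eq[of i] by (simp add: reindex \<beta>'_def e_def inv C_def mult.commute)
    show "d i = (\<Sum>m<8. A d m * (\<beta>' m * c (e m, i)))" for i
    proof -
      have "(\<Sum>k\<in>UNIV. C i k * (cramer_det C d k / matrix_det C)) = d i"
        using cramer_solution[of C "\<lambda>k. cramer_det C d k / matrix_det C" d] det by (simp add: C_def)
      moreover have "A d (inv_into {..<7} g k) * \<beta> k = cramer_det C d k / matrix_det C" for k
        using \<beta>0[of k] by (simp add: A_def inv)
      ultimately show ?thesis
        by (simp add: reindex \<beta>'_def e_def inv mult.assoc[symmetric] C_def) (simp add: A_def mult_ac)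
    qed
    show "\<exists>v. \<forall>m<7. (\<Sum>i\<in>UNIV. c (e m, i) * v i) = y m" for y
    proof -
      define r where "r k = y (inv_into {..<7} g k)" for k
      define v where "v k = cramer_det (\<lambda>i k. C k i) r k / matrix_det C" for k
      have "(\<Sum>i\<in>UNIV. C i k * v i) = r k" for k
        using cramer_solution[of "\<lambda>i k. C k i" v r] det matrix_det_transpose[of C] by (simp add: v_def C_def)
      moreover have "r (g m) = y m" if "m < 7" for m
        unfolding r_def using g that by (subst inv_into_f_f) (auto simp: bij_betw_def)
      ultimately have "\<forall>m<7. (\<Sum>i\<in>UNIV. c (e m, i) * v i) = y m" by (simp add: e_def C_def)
      then show ?thesis by blast
    qed
  qed
  moreover have "(\<lambda>m. lin_form (\<lambda>i. c (e m, i)) ^ 3) ` {..<8} = range (\<lambda>j. lin_form (\<lambda>i. c (j, i)) ^ 3)"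
    using image_image[of "\<lambda>j. lin_form (\<lambda>i. c (j, i)) ^ 3" e "{..<8}"] bij_betw_imp_surj_on[OF e] by simp
  ultimately show ?thesis
    unfolding fails_WLP_in_degree_def general_linear_form_def
    using holds_genericallyI[OF D D0] by simp
qed

theorem mainTheorem2:
  shows "general_linear_forms (\<lambda>L :: 8 \<Rightarrow> 7 mpoly.
           fails_WLP_in_degree (Idl\<^bsub>mpoly_ring\<^esub> (range (\<lambda>j. L j ^ 3))) 5)"
proof -
  have "card (UNIV :: 7 set) = card (UNIV - {0 :: 8})" by simp
  then obtain \<iota> :: "7 \<Rightarrow> 8" where \<iota>: "bij_betw \<iota> UNIV (UNIV - {0})"
    using finite_same_card_bij[OF finite finite] by blast
  define C :: "(8 \<times> 7 \<Rightarrow> complex) \<Rightarrow> 7 \<Rightarrow> 7 \<Rightarrow> complex" where "C c = (\<lambda>i k. c (\<iota> k, i))" for c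
  define r :: "(8 \<times> 7 \<Rightarrow> complex) \<Rightarrow> 7 \<Rightarrow> complex" where "r c = (\<lambda>i. c (0, i))" for c
  let ?P = "\<lambda>c. matrix_det (C c) * (\<Prod>k\<in>UNIV. cramer_det (C c) (r c) k)"
  have "polynomial_function ?P"
    unfolding C_def r_def
    by (intro polynomial_function_mult polynomial_function_prod polynomial_function_matrix_det
        polynomial_function_cramer_det polynomial_function_coord)
  moreover
  \<comment> \<open>the coordinate forms and their sum\<close>
  define w :: "8 \<times> 7 \<Rightarrow> complex" where "w = (\<lambda>(j, i). if j = 0 \<or> j = \<iota> i then 1 else 0)"
  have "?P w \<noteq> 0"
  proof -
    have \<iota>w: "\<iota> k \<noteq> 0" "\<iota> k = \<iota> i \<longleftrightarrow> k = i" for k i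
      using bij_betwE[OF \<iota>] bij_betw_imp_inj_on[OF \<iota>] by (auto simp: inj_on_def)
    then have Cw: "C w = (\<lambda>i k. if i = k then 1 else 0)"
      by (auto simp: C_def w_def fun_eq_iff)
    have 1: "matrix_det (C w) = 1"
      using det_I[where 'a = complex and 'n = 7] by (simp add: Cw matrix_det_def mat_def)
    have "cramer_det (C w) (r w) k = 1" for k
    proof -
      have "\<forall>i. (\<Sum>k\<in>UNIV. C w i k * 1) = r w i" by (simp add: Cw r_def) (simp add: w_def)
      then show ?thesis using cramer_solution[of "C w" "\<lambda>_. 1" "r w"] 1 by simp
    qed
    with 1 show ?thesis by simp
  qed
  ultimately show ?thesis
    unfolding general_linear_forms_def
  proof (rule holds_genericallyI)
    fix c assume "?P c \<noteq> 0"
    then show "fails_WLP_in_degree (Idl\<^bsub>mpoly_ring\<^esub> (range (\<lambda>j. lin_form (\<lambda>i. c (j, i)) ^ 3))) 5"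
      by (intro fails_WLP_generic[OF _ \<iota>]) (auto simp: C_def r_def)
  qed
qed

end
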